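(* There exist constants $C,\alpha,c_0,c_1>0$ with the following property. Let $M\ge1$ be an integer, $\mathcal{C}=\{y_1<\cdots<y_{M+1}\}\subset\mathbb{R}$, $\delta(\mathcal{C})=\max_{1\le k\le M}(y_{k+1}-y_k)$, and suppose $\delta(\mathcal{C})\le c_0$. Set $n=\alpha\,\delta(\mathcal{C})^{-1}$ and $A_n=n\sqrt{2}\,(1+Cn^{-4/3})$, and suppose $[-A_n,A_n]\subseteq[y_1,y_{M+1}]$. Then there exist real numbers $w_1,\dots,w_M$ such that $$\int_{\mathbb{R}}P(y)Q(y)\,dy=\sum_{k=1}^Mw_kP(y_k)Q(y_k),\qquad P,Q\in\Pi_n,$$ and $$|w_k|\le c_1|y_{k+1}-y_k|,\qquad k=1,\dots,M.$$ In particular, the measure $\nu$ that associates the mass $w_k$ with each point $y_k$, $k=1,\dots,M$, is in $MZ(n)$. Further, for every $\beta>0$ and $c_2>0$ there is a constant $c_3>0$, depending only on $\beta$ and $c_2$, such that if in addition $[y_1,y_{M+1}]\subset[-c_2n^\beta,c_2n^\beta]$, then $\sum_{k=1}^M|w_k|\le c_3n^\beta$.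
   Context: For real $n>0$, $\Pi_n$ is the set of functions on $\mathbb{R}$ of the form $x\mapsto\exp(-x^2/2)R(x)$, where $R$ is an algebraic polynomial of degree $<n^2$ (equivalently, the span of the orthonormalized Hermite functions $\psi_j$ with $\sqrt{j}<n$). A measure means a signed or complex valued Borel measure, or a positive sigma-finite Borel measure, on $\mathbb{R}$; $|\nu|$ denotes total variation. $MZ(n)$ is the set of measures $\nu$ on $\mathbb{R}$ such that $\int_{\mathbb{R}}P(y)Q(y)\,dy=\int_{\mathbb{R}}P(y)Q(y)\,d\nu(y)$ for all $P,Q\in\Pi_n$ and $\sup_{x\in\mathbb{R},\,r>0}\frac{|\nu|([x-r,x+r])}{r+1/n}<\infty$. *)

theory Defs
  imports "HOL-Analysis.Analysis" "HOL-Computational_Algebra.Polynomial"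
begin

definition weighted_polys :: "real \<Rightarrow> (real \<Rightarrow> real) set" where
  "weighted_polys n =
     {\<lambda>x. exp (- (x\<^sup>2 / 2)) * poly R x | R. real (degree R) < n\<^sup>2}"

text \<open>
  A finite signed measure is a complex measure with real values, so two cases suffice.
  A complex measure is a set function of which only the values on Borel sets are relevant;
  its values are finite, as usual for complex measures.
\<close>

datatype gen_measure = Pos "real measure" | Cplx "real set \<Rightarrow> complex"

text \<open>Applied to a constantly empty sequence, additivity already forces the empty set to have
  measure 0.\<close>

definition complex_measure :: "(real set \<Rightarrow> complex) \<Rightarrow> bool" where
  "complex_measure \<nu> \<longleftrightarrow>
     (\<forall>A :: nat \<Rightarrow> real set. range A \<subseteq> sets borel \<longrightarrow> disjoint_family A \<longrightarrow>
        (\<lambda>i. \<nu> (A i)) sums \<nu> (\<Union>i. A i))"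

fun is_gen_measure :: "gen_measure \<Rightarrow> bool" where
  "is_gen_measure (Pos \<mu>) \<longleftrightarrow> sets \<mu> = sets borel \<and> sigma_finite_measure \<mu>"
| "is_gen_measure (Cplx \<nu>) \<longleftrightarrow> complex_measure \<nu>"

fun total_variation :: "gen_measure \<Rightarrow> real set \<Rightarrow> ennreal" where
  "total_variation (Pos \<mu>) B = emeasure \<mu> B"
| "total_variation (Cplx \<nu>) B =
     (SUP A \<in> {A :: nat \<Rightarrow> real set.
                 range A \<subseteq> sets borel \<and> disjoint_family A \<and> (\<Union>i. A i) = B}.
        (\<Sum>i. ennreal (norm (\<nu> (A i)))))"

text \<open>
  The positive part of the Jordan decomposition of a finite signed measure; the negative part
  is the positive part of its negation. Since the empty set is among the sets \<open>A\<close>, truncating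
  negative values by \<^const>\<open>ennreal\<close> does not change the supremum.
\<close>

definition pos_part_measure :: "(real set \<Rightarrow> real) \<Rightarrow> real measure" where
  "pos_part_measure \<sigma> =
     measure_of UNIV (sets borel) (\<lambda>B. SUP A \<in> {A \<in> sets borel. A \<subseteq> B}. ennreal (\<sigma> A))"

definition signed_integrable :: "(real set \<Rightarrow> real) \<Rightarrow> (real \<Rightarrow> real) \<Rightarrow> bool" where
  "signed_integrable \<sigma> f \<longleftrightarrow>
     integrable (pos_part_measure \<sigma>) f \<and> integrable (pos_part_measure (\<lambda>B. - \<sigma> B)) f"

definition signed_integral :: "(real set \<Rightarrow> real) \<Rightarrow> (real \<Rightarrow> real) \<Rightarrow> real" where
  "signed_integral \<sigma> f =
     (LINT x|pos_part_measure \<sigma>. f x) - (LINT x|pos_part_measure (\<lambda>B. - \<sigma> B). f x)"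

fun gen_integrable :: "gen_measure \<Rightarrow> (real \<Rightarrow> real) \<Rightarrow> bool" where
  "gen_integrable (Pos \<mu>) f \<longleftrightarrow> integrable \<mu> f"
| "gen_integrable (Cplx \<nu>) f \<longleftrightarrow>
     signed_integrable (\<lambda>B. Re (\<nu> B)) f \<and> signed_integrable (\<lambda>B. Im (\<nu> B)) f"

fun gen_integral :: "gen_measure \<Rightarrow> (real \<Rightarrow> real) \<Rightarrow> complex" where
  "gen_integral (Pos \<mu>) f = complex_of_real (LINT x|\<mu>. f x)"
| "gen_integral (Cplx \<nu>) f =
     Complex (signed_integral (\<lambda>B. Re (\<nu> B)) f) (signed_integral (\<lambda>B. Im (\<nu> B)) f)"

text \<open>Integrability is required explicitly because the Bochner integral of a non-integrable
  function is 0 by convention.\<close>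

definition MZ :: "real \<Rightarrow> gen_measure set" where
  "MZ n = {\<nu>. is_gen_measure \<nu> \<and>
     (\<forall>P \<in> weighted_polys n. \<forall>Q \<in> weighted_polys n.
        gen_integrable \<nu> (\<lambda>y. P y * Q y) \<and>
        complex_of_real (LINT y|lborel. P y * Q y) = gen_integral \<nu> (\<lambda>y. P y * Q y)) \<and>
     (SUP x. SUP r \<in> {0<..}.
        total_variation \<nu> {x - r..x + r} / ennreal (r + 1 / n)) < top}"

definition point_masses :: "nat \<Rightarrow> (nat \<Rightarrow> real) \<Rightarrow> (nat \<Rightarrow> real) \<Rightarrow> gen_measure" where
  "point_masses M w y =
     Cplx (\<lambda>B. complex_of_real (\<Sum>k = 1..M. w k * indicator B (y k)))"

definition mesh :: "nat \<Rightarrow> (nat \<Rightarrow> real) \<Rightarrow> real" where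
  "mesh M y = Max ((\<lambda>k. y (k + 1) - y k) ` {1..M})"

end

theory Submission imports Defs "HOL-Probability.Distributions" "HOL-Complex_Analysis.Complex_Analysis" begin

text \<open>
  Products of two elements of \<open>weighted_polys n\<close> are \<open>F x = exp (- x\<^sup>2) * poly R x\<close> with \<open>degree R \<le> 2 * d\<close>,
  \<open>d < n\<^sup>2\<close>. If \<open>\<integral>\<bar>F\<bar> \<le> 6 * (\<Sum>k. (y (k + 1) - y k) * \<bar>F (y k)\<bar>)\<close> for all of them, a finite Hahn-Banach argument
  turns the functional \<open>F \<mapsto> \<integral>F\<close> into a combination of the point evaluations with weights
  \<open>\<bar>w k\<bar> \<le> 6 * (y (k + 1) - y k)\<close>. For that inequality, at most a quarter of \<open>\<integral>\<bar>F\<bar>\<close> lies outside \<open>[-A, A]\<close>,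
  an interval covered by the nodes. On \<open>[-10 n, 10 n]\<close> the Gaussian is, up to a factor, a polynomial of
  degree \<open>O(n\<^sup>2)\<close>, so \<open>F\<close> can be replaced there by a polynomial \<open>P\<close>. The Riemann sum of \<open>\<bar>P\<bar>\<close> differs from its
  integral by at most the mesh size times \<open>\<integral>\<bar>P'\<bar>\<close>, and Bernstein's inequality in the middle of an interval of
  length \<open>20 n\<close> bounds this integral by \<open>O(n) * \<integral>\<bar>F\<bar>\<close>, which is harmless when the mesh is a small
  multiple of \<open>1 / n\<close>.
\<close>

subsection \<open>The Joukowski substitution\<close>

text \<open>An upper bound for the moduli of the weights is dual to an L1 inequality. Hence every
  estimate is made in L1, and lossy constants are harmless as long as the error terms are a small
  part of the whole integral and can be absorbed. The shape of \<open>A\<close> comes from the edge.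
  A product has polynomial degree at most m = 2 d, and for the weight exp(-x^2) its mass sits on
  [-a, a] with a^2 = m + 2, essentially the Mhaskar-Rakhmanov-Saff number and about n sqrt 2. The
  mass beyond A is controlled by 1 / ((A - a) sqrt(A^2 - a^2)), where the denominator is of order
  sqrt n (A - a)^(3/2). A uniform bound asks for A - a of order n^(-1/3), that is, a relative
  enlargement of order n^(-4/3). The interval [-10 n, 10 n] is so wide because Bernstein's
  inequality deteriorates at endpoints: degree n^2 on a length of order n costs a factor of order n
  only away from the ends. All nodes that matter lie in the middle half [-5 n, 5 n].\<close>

lemma has_integral_joukowski_substitution:
  fixes g :: "real \<Rightarrow> real"
  assumes cont: "continuous_on UNIV g" and b: "b > 0"
  shows "((\<lambda>t. \<bar>sin t\<bar> * g (b * cos t)) has_integral (2 / b) * integral {-b..b} g) {0..2 * pi}"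
proof -
  have sub: "(\<lambda>t. b * cos t) ` S \<subseteq> {-b..b}" for S
  proof
    fix x assume "x \<in> (\<lambda>t. b * cos t) ` S"
    then obtain t where "x = b * cos t" by auto
    moreover have "b * cos t \<le> b * 1" "b * (-1) \<le> b * cos t"
      using b by (intro mult_left_mono; simp)+
    ultimately show "x \<in> {-b..b}" by auto
  qed
  have cg: "continuous_on {-b..b} g" by (rule continuous_on_subset[OF cont]) auto
  \<comment> \<open>The general substitution rule gives an oriented integral as a difference of two
    integrals, one of which is over an empty interval. Cosine decreases on [0, pi] and increases on
    [pi, 2 pi], which the sign of the sine compensates.\<close>
  have empty: "integral {b..- b} g = 0" using b by simp
  have A: "((\<lambda>t. (- b * sin t) *\<^sub>R g (b * cos t)) has_integral
      (integral {b * cos 0..b * cos pi} g - integral {b * cos pi..b * cos 0} g)) {0..pi}"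
    by (rule has_integral_substitution_general[where s = "{}" and c = "-b" and d = b])
       (auto intro!: sub cg continuous_intros derivative_eq_intros)
  have A': "((\<lambda>t. \<bar>sin t\<bar> * g (b * cos t)) has_integral (1 / b) * integral {-b..b} g) {0..pi}"
  proof (rule has_integral_eq)
    show "((\<lambda>t. (- 1 / b) * ((- b * sin t) *\<^sub>R g (b * cos t))) has_integral (1 / b) * integral {-b..b} g) {0..pi}"
      using has_integral_mult_right[OF A, of "- 1 / b"] empty by (simp add: )
  qed (use b in \<open>auto simp: sin_ge_zero\<close>)
  have B: "((\<lambda>t. (- b * sin t) *\<^sub>R g (b * cos t)) has_integral
      (integral {b * cos pi..b * cos (2 * pi)} g - integral {b * cos (2 * pi)..b * cos pi} g)) {pi..2 * pi}"
    by (rule has_integral_substitution_general[where s = "{}" and c = "-b" and d = b])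
       (auto intro!: sub cg continuous_intros derivative_eq_intros)
  have B': "((\<lambda>t. \<bar>sin t\<bar> * g (b * cos t)) has_integral (1 / b) * integral {-b..b} g) {pi..2 * pi}"
  proof (rule has_integral_eq)
    show "((\<lambda>t. (1 / b) * ((- b * sin t) *\<^sub>R g (b * cos t))) has_integral (1 / b) * integral {-b..b} g) {pi..2 * pi}"
      using has_integral_mult_right[OF B, of "1 / b"] empty by (simp add: )
    fix t :: real assume t: "t \<in> {pi..2 * pi}"
    have "sin (t - pi) \<ge> 0" using t by (intro sin_ge_zero) auto
    then show "(1 / b) * ((- b * sin t) *\<^sub>R g (b * cos t)) = \<bar>sin t\<bar> * g (b * cos t)"
      using b by (simp add: sin_diff)
  qed
  from has_integral_combine[OF _ _ A' B'] show ?thesis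
    by simp
qed

text \<open>Since z + 1/z = (z^2 + 1)/z, the factor z^m clears every pole at the origin. On the unit
  circle it has modulus one, so for real \<open>c\<close> the moduli of \<open>P\<close> on
  [-2c, 2c] become those of a polynomial on the circle, at the price of doubling the degree.\<close>

lemma joukowski_poly:
  fixes P :: "complex poly"
  assumes "degree P \<le> m"
  shows "\<exists>p. degree p \<le> 2 * m \<and> (\<forall>z. z \<noteq> 0 \<longrightarrow> poly p z = z ^ m * poly P (c * (z + 1 / z)))"
proof (intro exI conjI allI impI)
  define p where "p = (\<Sum>k\<le>m. smult (coeff P k * c ^ k) (monom 1 (m - k) * [:1, 0, 1:] ^ k))"
  show "degree p \<le> 2 * m"
    unfolding p_def
  proof (rule degree_sum_le)
    fix k assume "k \<in> {..m}"
    have "degree (smult (coeff P k * c ^ k) (monom 1 (m - k) * [:1, 0, 1:] ^ k))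
       \<le> degree (monom 1 (m - k) * [:1, 0, 1:] ^ k :: complex poly)"
      by (rule degree_smult_le)
    also have "\<dots> \<le> degree (monom (1::complex) (m - k)) + degree ([:1, 0, 1:] ^ k :: complex poly)"
      by (rule degree_mult_le)
    also have "\<dots> \<le> (m - k) + 2 * k"
      using degree_power_le[of "[:1, 0, 1:] :: complex poly" k] by (simp add: degree_monom_eq)
    also have "\<dots> \<le> 2 * m" using \<open>k \<in> {..m}\<close> by auto
    finally show "degree (smult (coeff P k * c ^ k) (monom 1 (m - k) * [:1, 0, 1:] ^ k)) \<le> 2 * m" .
  qed auto
  fix z :: complex assume z: "z \<noteq> 0"
  have *: "z ^ (m - k) * (1 + z * z) ^ k = z ^ m * (z + 1 / z) ^ k" if "k \<le> m" for k
  proof -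
    have "1 + z * z = z * (z + 1 / z)" using z by (simp add: field_simps)
    then have "z ^ (m - k) * (1 + z * z) ^ k = z ^ (m - k) * z ^ k * (z + 1 / z) ^ k"
      by (simp add: power_mult_distrib)
    also have "z ^ (m - k) * z ^ k = z ^ m" using that by (simp flip: power_add)
    finally show ?thesis .
  qed
  have "poly P (c * (z + 1 / z)) = (\<Sum>k\<le>m. coeff P k * (c * (z + 1 / z)) ^ k)"
    unfolding poly_altdef using assms
    by (intro sum.mono_neutral_left) (auto simp: coeff_eq_0)
  then have "z ^ m * poly P (c * (z + 1 / z)) = (\<Sum>k\<le>m. coeff P k * c ^ k * (z ^ m * (z + 1 / z) ^ k))"
    by (simp add: sum_distrib_left power_mult_distrib mult_ac)
  also have "\<dots> = (\<Sum>k\<le>m. coeff P k * c ^ k * (z ^ (m - k) * (1 + z * z) ^ k))"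
    by (intro sum.cong) (simp_all add: *)
  also have "\<dots> = poly p z"
    unfolding p_def by (simp add: poly_sum poly_monom poly_power mult_ac)
  finally show "poly p z = z ^ m * poly P (c * (z + 1 / z))" by simp
qed

subsection \<open>Bernstein inequalities in $L^1$\<close>

lemma sum_root_of_unity_powers:
  fixes d l :: nat
  assumes "d > 0"
  shows "(\<Sum>j<2 * d. cis (pi / d) ^ (j * l)) = (if 2 * d dvd l then of_nat (2 * d) else 0)"
proof -
  let ?u = "cis (pi / d) ^ l"
  have u: "?u = exp (2 * of_real pi * \<i> * of_nat l / of_nat (2 * d))"
    using assms by (simp add: Complex.DeMoivre, simp add: cis_conv_exp field_simps)
  have u1: "?u = 1 \<longleftrightarrow> 2 * d dvd l"
    unfolding u using complex_root_unity_eq_1[of "2 * d" l] assms by simp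
  have "(cis (pi / d)) ^ (2 * d) = 1"
    using assms by (simp only: Complex.DeMoivre) simp
  then have u2: "?u ^ (2 * d) = 1"
    by (metis power_commutes power_mult power_one mult.commute)
  have "(\<Sum>j<2 * d. cis (pi / d) ^ (j * l)) = (\<Sum>j<2 * d. ?u ^ j)"
    by (simp add: mult.commute flip: power_mult)
  also have "\<dots> = (if 2 * d dvd l then of_nat (2 * d) else 0)"
  proof (cases "2 * d dvd l")
    case True
    then have "?u = 1" using u1 by simp
    then show ?thesis using True by simp
  next
    case False
    then have "?u \<noteq> 1" using u1 by simp
    then show ?thesis using False u2 by (simp add: geometric_sum)
  qed
  finally show ?thesis .
qed

text \<open>M. Riesz's interpolation formula. The multiplier \<open>k\<close> on \<open>{0..d}\<close> is the restriction of a
  triangle wave of period \<open>2 d\<close>, so its discrete Fourier coefficients \<open>c j\<close> are those of a shifted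
  Fejer kernel and their moduli add up to \<open>d\<close>.\<close>

lemma riesz_interpolation:
  fixes d :: nat
  assumes d: "d > 0"
  shows "\<exists>c :: nat \<Rightarrow> complex. (\<Sum>j<2 * d. norm (c j)) = d \<and>
     (\<forall>k\<le>d. (\<Sum>j<2 * d. c j * cis (pi / d) ^ (j * k)) = of_nat k)"
proof -
  define w where "w = cis (pi / d)"
  have w2d: "w ^ (2 * d) = 1" unfolding w_def using d by (simp only: Complex.DeMoivre) simp
  have nw: "norm w = 1" by (simp add: w_def)
  define S where "S j = (\<Sum>i<d. w ^ (j * i))" for j
  \<comment> \<open>\<open>S j * cnj (S j)\<close> is a squared Dirichlet sum, i.e. a multiple of
    the Fejer kernel, with coefficients d - |l|. The factor \<open>w ^ (j * d)\<close> is (-1)^j and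
    shifts frequencies by half the period 2d, so that the peak d sits at k = d and the value 0 at k
    = 0.\<close>
  define c where "c j = w ^ (j * d) * (1 / of_nat (2 * d)) * (S j * cnj (S j))" for j
  \<comment> \<open>Conjugation on the circle is inversion; the exponent 2d - i keeps everything in
    the natural numbers.\<close>
  have cnjw: "cnj (w ^ (j * i)) = w ^ (j * (2 * d - i))" if "i < d" for i j
  proof -
    have "w ^ (j * i) * w ^ (j * (2 * d - i)) = (w ^ (2 * d)) ^ j"
      using that by (simp flip: power_add power_mult add: algebra_simps flip: distrib_left)
    then have "w ^ (j * i) * w ^ (j * (2 * d - i)) = 1" by (simp add: w2d)
    moreover have "w ^ (j * i) * cnj (w ^ (j * i)) = 1"
      using nw by (simp add: complex_norm_square[symmetric] norm_power del: complex_cnj_power)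
    ultimately show ?thesis
      by (metis mult_cancel_left mult_zero_left zero_neq_one)
  qed
  have SS: "S j * cnj (S j) = (\<Sum>i<d. \<Sum>i'<d. w ^ (j * (i + (2 * d - i'))))" for j
  proof -
    have "cnj (S j) = (\<Sum>i'<d. w ^ (j * (2 * d - i')))"
      unfolding S_def cnj_sum by (intro sum.cong) (use cnjw in auto)
    then show ?thesis
      unfolding S_def by (simp only: sum_product distrib_left power_add)
  qed
  \<comment> \<open>Orthogonality of the roots of unity turns the Fourier sum into a count of pairs
    with i' - i congruent to l modulo 2d.\<close>
  have count: "(\<Sum>j<2 * d. w ^ (j * l) * (S j * cnj (S j))) =
      of_nat (2 * d) * of_nat (card {(i, i'). i < d \<and> i' < d \<and> 2 * d dvd l + (i + (2 * d - i'))})" for l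
  proof -
    have "(\<Sum>j<2 * d. w ^ (j * l) * (S j * cnj (S j))) =
        (\<Sum>j<2 * d. \<Sum>i<d. \<Sum>i'<d. w ^ (j * (l + (i + (2 * d - i')))))"
      unfolding SS by (simp only: sum_distrib_left power_add distrib_left)
    also have "\<dots> = (\<Sum>i<d. \<Sum>j<2 * d. \<Sum>i'<d. w ^ (j * (l + (i + (2 * d - i')))))"
      by (rule sum.swap)
    also have "\<dots> = (\<Sum>i<d. \<Sum>i'<d. \<Sum>j<2 * d. w ^ (j * (l + (i + (2 * d - i')))))"
      by (intro sum.cong refl sum.swap)
    also have "\<dots> = (\<Sum>i<d. \<Sum>i'<d. if 2 * d dvd l + (i + (2 * d - i')) then of_nat (2 * d) else 0)"
      unfolding w_def sum_root_of_unity_powers[OF d] ..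
    also have "\<dots> = (\<Sum>p\<in>{..<d} \<times> {..<d}. if 2 * d dvd l + (fst p + (2 * d - snd p)) then of_nat (2 * d) else 0)"
      by (simp only: sum.cartesian_product case_prod_unfold)
    also have "\<dots> = (\<Sum>p\<in>{p\<in>{..<d} \<times> {..<d}. 2 * d dvd l + (fst p + (2 * d - snd p))}. of_nat (2 * d))"
      by (subst sum.inter_filter) auto
    also have "{p\<in>{..<d} \<times> {..<d}. 2 * d dvd l + (fst p + (2 * d - snd p))} =
        {(i, i'). i < d \<and> i' < d \<and> 2 * d dvd l + (i + (2 * d - i'))}" by auto
    finally show ?thesis by simp
  qed
  have card_eq: "card {(i, i'). i < d \<and> i' < d \<and> 2 * d dvd (d + k) + (i + (2 * d - i'))} = k" if "k \<le> d" for k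
  proof -
    have "{(i, i'). i < d \<and> i' < d \<and> 2 * d dvd (d + k) + (i + (2 * d - i'))} = (\<lambda>i. (i, i + k - d)) ` {d - k..<d}"
    proof (intro equalityI subsetI)
      fix p assume "p \<in> {(i, i'). i < d \<and> i' < d \<and> 2 * d dvd (d + k) + (i + (2 * d - i'))}"
      then obtain i i' where p: "p = (i, i')" "i < d" "i' < d" "2 * d dvd (d + k) + (i + (2 * d - i'))" by auto
      then obtain q where q: "(d + k) + (i + (2 * d - i')) = 2 * d * q" by (auto elim: dvdE)
      have "2 * d * 1 < 2 * d * q" "2 * d * q < 2 * d * 3" using q p that by linarith+
      then have "q = 2" using d by (simp only: mult_less_cancel1) linarith
      then have "i + k = i' + d" using q p by simp
      then show "p \<in> (\<lambda>i. (i, i + k - d)) ` {d - k..<d}" using p by auto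
    next
      fix p assume "p \<in> (\<lambda>i. (i, i + k - d)) ` {d - k..<d}"
      then obtain i where i: "p = (i, i + k - d)" "d - k \<le> i" "i < d" by auto
      then have "(d + k) + (i + (2 * d - (i + k - d))) = 2 * d * 2" using that by simp
      then show "p \<in> {(i, i'). i < d \<and> i' < d \<and> 2 * d dvd (d + k) + (i + (2 * d - i'))}"
        using i that by (auto intro: dvdI)
    qed
    then show ?thesis
      using that by (simp add: card_image inj_on_def)
  qed
  have card_0: "card {(i, i'). i < d \<and> i' < d \<and> 2 * d dvd 0 + (i + (2 * d - i'))} = d"
  proof -
    have "{(i, i'). i < d \<and> i' < d \<and> 2 * d dvd 0 + (i + (2 * d - i'))} = (\<lambda>i. (i, i)) ` {..<d}"
    proof (intro equalityI subsetI)
      fix p assume "p \<in> {(i, i'). i < d \<and> i' < d \<and> 2 * d dvd 0 + (i + (2 * d - i'))}"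
      then obtain i i' where p: "p = (i, i')" "i < d" "i' < d" "2 * d dvd i + (2 * d - i')" by auto
      then obtain q where q: "i + (2 * d - i') = 2 * d * q" by (auto elim: dvdE)
      have "2 * d * 0 < 2 * d * q" "2 * d * q < 2 * d * 2" using q p by linarith+
      then have "q = 1" using d by (simp only: mult_less_cancel1) linarith
      then show "p \<in> (\<lambda>i. (i, i)) ` {..<d}" using p q by auto
    qed auto
    then show ?thesis by (simp add: card_image inj_on_def)
  qed
  have "(\<Sum>j<2 * d. c j * cis (pi / d) ^ (j * k)) = of_nat k" if k: "k \<le> d" for k
  proof -
    have "(\<Sum>j<2 * d. c j * w ^ (j * k)) = (\<Sum>j<2 * d. w ^ (j * (d + k)) * (S j * cnj (S j))) / of_nat (2 * d)"
    unfolding c_def sum_divide_distrib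
    by (intro sum.cong) (simp_all add: distrib_left power_add)
  also have "\<dots> = of_nat k"
    unfolding count card_eq[OF k] using d by simp
  finally show ?thesis unfolding w_def .
  qed
  moreover have "(\<Sum>j<2 * d. norm (c j)) = d"
  proof -
    \<comment> \<open>The phase has modulus one and \<open>S j * cnj (S j)\<close> is nonnegative,
      so the moduli add up to the count at frequency 0.\<close>
    have "of_real (norm (c j)) = (1 / of_nat (2 * d)) * (w ^ (j * 0) * (S j * cnj (S j)))" for j
      unfolding c_def by (simp add: norm_mult norm_divide norm_power nw complex_norm_square[symmetric] power2_eq_square)
    then have "complex_of_real (\<Sum>j<2 * d. norm (c j)) = (1 / of_nat (2 * d)) * (\<Sum>j<2 * d. w ^ (j * 0) * (S j * cnj (S j)))"
      by (simp only: of_real_sum sum_distrib_left)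
    also have "\<dots> = of_nat d" unfolding count card_0 using d by simp
    finally show ?thesis by (metis of_real_eq_iff of_real_of_nat_eq)
  qed
  ultimately show ?thesis by blast
qed


lemma integral_circle_rotate:
  fixes f :: "complex \<Rightarrow> real"
  assumes f: "continuous_on UNIV f" and c: "0 \<le> c" "c \<le> 2 * pi"
  shows "integral {0..2 * pi} (\<lambda>t. f (cis (t + c))) = integral {0..2 * pi} (\<lambda>t. f (cis t))"
proof -
  define F where "F t = f (cis t)" for t
  have cF: "continuous_on S F" for S
    unfolding F_def by (intro continuous_on_compose2[OF f] continuous_intros) auto
  have per: "F (t + 2 * pi) = F t" for t
    unfolding F_def by (simp flip: cis_mult)
  have "integral {0..2 * pi} (F \<circ> (\<lambda>t. t + c)) = integral {0 + c..2 * pi + c} F"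
    by (rule integral_shift[OF cF])
  also have "\<dots> = integral {c..2 * pi} F + integral {2 * pi..2 * pi + c} F"
    using Henstock_Kurzweil_Integration.integral_combine[of c "2 * pi" "2 * pi + c" F] integrable_continuous_interval[OF cF] c by simp
  also have "integral {2 * pi..2 * pi + c} F = integral {0..c} (F \<circ> (\<lambda>t. t + 2 * pi))"
    using integral_shift[OF cF, where a = 0 and b = c and c = "2 * pi"] by (simp add: add.commute)
  also have "F \<circ> (\<lambda>t. t + 2 * pi) = F"
    using per by auto
  also have "integral {c..2 * pi} F + integral {0..c} F = integral {0..2 * pi} F"
    using Henstock_Kurzweil_Integration.integral_combine[of 0 c "2 * pi" F] integrable_continuous_interval[OF cF] c by simp
  finally show ?thesis by (simp add: F_def[abs_def] o_def)
qed

text \<open>The operator q \<mapsto> z q'(z) multiplies the k-th coefficient by k. Riesz's formula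
  therefore writes it as a combination of rotations of \<open>q\<close> with total weight d, and
  rotations preserve the L1 norm on the circle.\<close>

lemma bernstein_circle_L1:
  fixes q :: "complex poly"
  assumes q: "degree q \<le> d" and d: "d > 0"
  shows "integral {0..2 * pi} (\<lambda>t. norm (poly (pderiv q) (cis t))) \<le>
         d * integral {0..2 * pi} (\<lambda>t. norm (poly q (cis t)))"
proof -
  obtain c :: "nat \<Rightarrow> complex" where c: "(\<Sum>j<2 * d. norm (c j)) = d"
      "\<And>k. k \<le> d \<Longrightarrow> (\<Sum>j<2 * d. c j * cis (pi / d) ^ (j * k)) = of_nat k"
    using riesz_interpolation[OF d] by blast
  define s where "s j = of_nat j * (pi / d)" for j :: nat
  have cp: "poly q z = (\<Sum>k\<le>d. coeff q k * z ^ k)" for z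
    unfolding poly_altdef using q
    by (intro sum.mono_neutral_left) (auto simp: coeff_eq_0)
  have "poly (pCons 0 (pderiv q)) z = (\<Sum>k\<le>d. of_nat k * coeff q k * z ^ k)" for z
  proof -
    have "degree (pCons 0 (pderiv q)) \<le> d"
      using q d by (cases "degree q = 0") (auto simp: degree_pderiv degree_pCons_eq_if pderiv_eq_0_iff)
    then have "poly (pCons 0 (pderiv q)) z = (\<Sum>k\<le>d. coeff (pCons 0 (pderiv q)) k * z ^ k)"
      unfolding poly_altdef by (intro sum.mono_neutral_left) (auto intro: coeff_eq_0)
    also have "\<dots> = (\<Sum>k\<le>d. of_nat k * coeff q k * z ^ k)"
      by (intro sum.cong) (auto simp: coeff_pCons coeff_pderiv split: nat.splits)
    finally show ?thesis .
  qed
  then have "z * poly (pderiv q) z = (\<Sum>k\<le>d. of_nat k * coeff q k * z ^ k)" for z by simp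
  also have "\<dots> z = (\<Sum>k\<le>d. \<Sum>j<2 * d. c j * (coeff q k * (z * cis (s j)) ^ k))" for z
  proof (intro sum.cong refl)
    fix k assume "k \<in> {..d}"
    then have "of_nat k * coeff q k * z ^ k = (\<Sum>j<2 * d. c j * cis (pi / d) ^ (j * k)) * coeff q k * z ^ k"
      using c(2) by simp
    also have "\<dots> = (\<Sum>j<2 * d. c j * (coeff q k * (z * cis (s j)) ^ k))"
      unfolding sum_distrib_right
    proof (intro sum.cong refl)
      fix j
      have "cis (s j) ^ k = cis (pi / d) ^ (j * k)"
        unfolding power_mult s_def Complex.DeMoivre ..
      then show "c j * cis (pi / d) ^ (j * k) * coeff q k * z ^ k = c j * (coeff q k * (z * cis (s j)) ^ k)"
        by (simp add: power_mult_distrib)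
    qed
    finally show "of_nat k * coeff q k * z ^ k = (\<Sum>j<2 * d. c j * (coeff q k * (z * cis (s j)) ^ k))" .
  qed
  also have "\<dots> z = (\<Sum>j<2 * d. c j * poly q (z * cis (s j)))" for z
    by (subst sum.swap) (simp add: cp sum_distrib_left)
  finally have key: "z * poly (pderiv q) z = (\<Sum>j<2 * d. c j * poly q (z * cis (s j)))" for z .
  have "norm (poly (pderiv q) (cis t)) \<le> (\<Sum>j<2 * d. norm (c j) * norm (poly q (cis (t + s j))))" for t
  proof -
    have "norm (poly (pderiv q) (cis t)) = norm (cis t * poly (pderiv q) (cis t))"
      by (simp add: norm_mult)
    also have "\<dots> \<le> (\<Sum>j<2 * d. norm (c j * poly q (cis t * cis (s j))))"
      unfolding key by (rule norm_sum)
    finally show ?thesis by (simp add: norm_mult cis_mult)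
  qed
  then have "integral {0..2 * pi} (\<lambda>t. norm (poly (pderiv q) (cis t))) \<le>
     integral {0..2 * pi} (\<lambda>t. \<Sum>j<2 * d. norm (c j) * norm (poly q (cis (t + s j))))"
    by (intro integral_le integrable_continuous_interval continuous_intros) auto
  also have "\<dots> = (\<Sum>j<2 * d. integral {0..2 * pi} (\<lambda>t. norm (c j) * norm (poly q (cis (t + s j)))))"
    by (intro integral_sum integrable_continuous_interval continuous_intros) auto
  also have "\<dots> = (\<Sum>j<2 * d. norm (c j) * integral {0..2 * pi} (\<lambda>t. norm (poly q (cis t))))"
  proof (intro sum.cong refl)
    fix j assume j: "j \<in> {..<2 * d}"
    have "s j \<le> of_nat (2 * d) * (pi / d)" unfolding s_def
      using j by (intro mult_right_mono) (auto simp del: of_nat_mult)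
    then have "s j \<le> 2 * pi" using d by simp
    then have "integral {0..2 * pi} (\<lambda>t. norm (poly q (cis (t + s j)))) = integral {0..2 * pi} (\<lambda>t. norm (poly q (cis t)))"
      by (intro integral_circle_rotate[where f = "\<lambda>z. norm (poly q z)"] continuous_intros) (auto simp: s_def)
    then show "integral {0..2 * pi} (\<lambda>t. norm (c j) * norm (poly q (cis (t + s j)))) =
      norm (c j) * integral {0..2 * pi} (\<lambda>t. norm (poly q (cis t)))" by simp
  qed
  also have "\<dots> = d * integral {0..2 * pi} (\<lambda>t. norm (poly q (cis t)))"
    using c(1) by (simp flip: sum_distrib_right)
  finally show ?thesis .
qed

lemma poly_map_of_real: "poly (map_poly of_real P) (of_real x) = (of_real (poly P x) :: complex)"
  by (induction P) (auto simp: map_poly_pCons)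

text \<open>Put x = b cos t and multiply by sin t: the sine is the Jacobian, so \<open>T\<close>
  has, up to a constant, the L1 norm of \<open>P\<close> on [-b, b], while T' contains P' with
  weight sin^2 t = 1 - (x/b)^2. On the middle half this weight is at least 3/4, which is why the
  derivative is bounded only there.\<close>

lemma bernstein_interval_L1:
  fixes P :: "real poly"
  assumes P: "degree P \<le> D" and b: "b > 0"
  shows "integral {-(b / 2)..b / 2} (\<lambda>x. \<bar>poly (pderiv P) x\<bar>) \<le>
         4 / 3 * (3 * real D + 4) / b * integral {-b..b} (\<lambda>x. \<bar>poly P x\<bar>)"
proof -
  define Pc :: "complex poly" where "Pc = map_poly of_real P"
  have "degree Pc \<le> D" unfolding Pc_def using P by (intro degree_le) (auto simp: coeff_map_poly coeff_eq_0)
  then obtain p where p: "degree p \<le> 2 * D"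
      "\<And>z. z \<noteq> 0 \<Longrightarrow> poly p z = z ^ D * poly Pc (of_real (b / 2) * (z + 1 / z))"
    using joukowski_poly by blast
  \<comment> \<open>On the circle z^2 - 1 = 2 i z sin t, so this factor supplies the sine in
    \<open>T\<close>.\<close>
  define q where "q = p * [:-1, 0, 1:]"
  define T where "T t = poly P (b * cos t) * sin t" for t
  define T' where "T' t = - b * poly (pderiv P) (b * cos t) * (sin t)\<^sup>2 + poly P (b * cos t) * cos t" for t
  have degq: "degree q \<le> 2 * D + 2"
  proof -
    have "degree q \<le> degree p + degree ([:-1, 0, 1:] :: complex poly)" unfolding q_def by (rule degree_mult_le)
    then show ?thesis using p(1) by simp
  qed
  have pc: "poly p (cis t) = cis (D * t) * of_real (poly P (b * cos t))" for t :: real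
  proof -
    have "of_real (b / 2) * (cis t + 1 / cis t) = complex_of_real (b * cos t)"
    proof -
      have "1 / cis t = cis (- t)" by (simp add: divide_inverse)
      then show ?thesis by (simp only:) (simp add: complex_eq_iff)
    qed
    then show ?thesis
      using p(2)[of "cis t"] by (simp only: Pc_def poly_map_of_real Complex.DeMoivre) simp
  qed
  have qT: "poly q (cis t) = 2 * \<i> * cis ((D + 1) * t) * of_real (T t)" for t :: real
  proof -
    have "cis t * cis t - 1 = 2 * \<i> * of_real (sin t) * cis t"
      using sin_cos_squared_add[of t] by (auto simp: complex_eq_iff power2_eq_square)
    moreover have "poly q (cis t) = poly p (cis t) * (cis t * cis t - 1)"
      unfolding q_def by (simp add: algebra_simps)
    ultimately have "poly q (cis t) = poly p (cis t) * (2 * \<i> * of_real (sin t) * cis t)"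
      by simp
    also have "\<dots> = 2 * \<i> * (cis (D * t) * cis t) * of_real (T t)"
      unfolding pc T_def by (simp add: mult_ac)
    finally show ?thesis by (simp add: cis_mult algebra_simps)
  qed
  have nq: "norm (poly q (cis t)) = 2 * \<bar>T t\<bar>" for t
    unfolding qT by (simp add: norm_mult)
  have dT: "(T has_real_derivative T' t) (at t)" for t
    unfolding T_def T'_def
    by (auto intro!: derivative_eq_intros simp: power2_eq_square algebra_simps)
  \<comment> \<open>Differentiate the identity \<open>qT\<close>; the second term stems from the
    rotating factor \<open>cis ((D + 1) * t)\<close>.\<close>
  have T'_le: "\<bar>T' t\<bar> \<le> 1 / 2 * norm (poly (pderiv q) (cis t)) + (D + 1) * \<bar>T t\<bar>" for t
  proof -
    have dcis: "((\<lambda>t. cis (k * t)) has_vector_derivative (of_real k * \<i> * cis (k * t))) (at t)" for k :: real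
    proof -
      have "((\<lambda>z. exp (\<i> * of_real k * z)) has_field_derivative (\<i> * of_real k * exp (\<i> * of_real k * of_real t))) (at (of_real t))"
        by (auto intro!: derivative_eq_intros)
      from has_vector_derivative_real_field[OF this] show ?thesis
        by (simp add: cis_conv_exp mult_ac)
    qed
    have "((\<lambda>t. poly q (cis t)) has_vector_derivative (\<i> * cis t * poly (pderiv q) (cis t))) (at t)"
      using field_vector_diff_chain_at[OF dcis[of 1] poly_DERIV] by (simp add: o_def)
    moreover have "((\<lambda>t. 2 * \<i> * cis ((D + 1) * t) * of_real (T t)) has_vector_derivative
        (2 * \<i> * cis ((D + 1) * t) * of_real (T' t) + 2 * \<i> * (of_real (real (D + 1)) * \<i> * cis ((D + 1) * t)) * of_real (T t))) (at t)"
      by (intro has_vector_derivative_mult has_vector_derivative_mult_right dcis has_vector_derivative_of_real dT)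
    ultimately have "\<i> * cis t * poly (pderiv q) (cis t) = 2 * \<i> * cis ((D + 1) * t) * of_real (T' t) + 2 * \<i> * (of_real (real (D + 1)) * \<i> * cis ((D + 1) * t)) * of_real (T t)"
      unfolding qT by (rule vector_derivative_unique_at)
    then have "2 * \<i> * cis ((D + 1) * t) * of_real (T' t) = \<i> * cis t * poly (pderiv q) (cis t) - 2 * \<i> * (of_real (real (D + 1)) * \<i> * cis ((D + 1) * t)) * of_real (T t)"
      by simp
    then have "norm (2 * \<i> * cis ((D + 1) * t) * of_real (T' t)) \<le> norm (\<i> * cis t * poly (pderiv q) (cis t)) + norm (2 * \<i> * (of_real (real (D + 1)) * \<i> * cis ((D + 1) * t)) * of_real (T t))"
      by (metis norm_triangle_ineq4)
    moreover have "cmod (1 + of_nat D) = 1 + real D" by (metis norm_of_nat of_nat_Suc)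
    ultimately have "2 * \<bar>T' t\<bar> \<le> norm (poly (pderiv q) (cis t)) + (2 + 2 * real D) * \<bar>T t\<bar>"
      by (simp add: norm_mult)
    then show ?thesis by (simp add: algebra_simps)
  qed
  have cT: "continuous_on S T" "continuous_on S T'" for S
    unfolding T_def T'_def by (intro continuous_intros)+
  have IT: "integral {0..2 * pi} (\<lambda>t. \<bar>T t\<bar>) = 2 / b * integral {-b..b} (\<lambda>x. \<bar>poly P x\<bar>)"
  proof -
    have "((\<lambda>t. \<bar>sin t\<bar> * \<bar>poly P (b * cos t)\<bar>) has_integral 2 / b * integral {-b..b} (\<lambda>x. \<bar>poly P x\<bar>)) {0..2 * pi}"
      by (intro has_integral_joukowski_substitution[where g = "\<lambda>x. \<bar>poly P x\<bar>"] b continuous_intros)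
    then show ?thesis by (simp add: T_def abs_mult integral_unique mult.commute)
  qed
  \<comment> \<open>The circle inequality for degree 2D + 2 contributes 2 (D + 1), the rotating
    factor another D + 1.\<close>
  have IT': "integral {0..2 * pi} (\<lambda>t. \<bar>T' t\<bar>) \<le> 3 * (real D + 1) * integral {0..2 * pi} (\<lambda>t. \<bar>T t\<bar>)"
  proof -
    have "integral {0..2 * pi} (\<lambda>t. \<bar>T' t\<bar>) \<le> integral {0..2 * pi} (\<lambda>t. 1 / 2 * norm (poly (pderiv q) (cis t)) + (D + 1) * \<bar>T t\<bar>)"
      using T'_le by (intro integral_le integrable_continuous_interval continuous_intros cT) auto
    also have "\<dots> = 1 / 2 * integral {0..2 * pi} (\<lambda>t. norm (poly (pderiv q) (cis t))) + (D + 1) * integral {0..2 * pi} (\<lambda>t. \<bar>T t\<bar>)"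
      by (subst integral_add)
         (auto intro!: integrable_continuous_interval continuous_intros cT)
    also have "integral {0..2 * pi} (\<lambda>t. norm (poly (pderiv q) (cis t))) \<le> real (2 * D + 2) * integral {0..2 * pi} (\<lambda>t. norm (poly q (cis t)))"
      by (rule bernstein_circle_L1[OF degq]) auto
    also have "integral {0..2 * pi} (\<lambda>t. norm (poly q (cis t))) = 2 * integral {0..2 * pi} (\<lambda>t. \<bar>T t\<bar>)"
      unfolding nq by simp
    finally show ?thesis by (simp add: algebra_simps)
  qed
  define g where "g x = \<bar>poly (pderiv P) x\<bar> * (1 - (x / b)\<^sup>2)" for x
  have cg: "continuous_on S g" for S unfolding g_def by (intro continuous_intros) (use b in auto)
  have subst: "((\<lambda>t. \<bar>sin t\<bar> * g (b * cos t)) has_integral 2 / b * integral {-b..b} g) {0..2 * pi}"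
    by (intro has_integral_joukowski_substitution b cg)
  \<comment> \<open>Solve the formula for \<open>T'\<close> for the term with P'. The additional
    factor |sin t| is the Jacobian for integrating back over x.\<close>
  have gT: "\<bar>sin t\<bar> * g (b * cos t) \<le> 1 / b * (\<bar>T' t\<bar> + \<bar>T t\<bar>)" for t
  proof -
    have "b * (\<bar>poly (pderiv P) (b * cos t)\<bar> * (sin t)\<^sup>2) = \<bar>- T' t + poly P (b * cos t) * cos t\<bar>"
      unfolding T'_def using b by (simp add: abs_mult)
    also have "\<dots> \<le> \<bar>T' t\<bar> + \<bar>poly P (b * cos t)\<bar> * 1"
      by (rule order_trans[OF abs_triangle_ineq]) (simp add: abs_mult mult_left_le)
    finally have "\<bar>sin t\<bar> * (b * (\<bar>poly (pderiv P) (b * cos t)\<bar> * (sin t)\<^sup>2)) \<le> \<bar>sin t\<bar> * (\<bar>T' t\<bar> + \<bar>poly P (b * cos t)\<bar>)"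
      by (intro mult_left_mono) auto
    also have "\<dots> \<le> \<bar>T' t\<bar> + \<bar>T t\<bar>"
      using mult_right_mono[of "\<bar>sin t\<bar>" 1 "\<bar>T' t\<bar>"] by (simp add: T_def abs_mult algebra_simps)
    also have "(sin t)\<^sup>2 = 1 - (b * cos t / b)\<^sup>2"
      using b by (simp add: sin_squared_eq)
    finally show ?thesis using b unfolding g_def by (simp add: field_simps)
  qed
  have "3 / 4 * integral {-(b / 2)..b / 2} (\<lambda>x. \<bar>poly (pderiv P) x\<bar>) = integral {-(b / 2)..b / 2} (\<lambda>x. 3 / 4 * \<bar>poly (pderiv P) x\<bar>)"
    by simp
  also have "\<dots> \<le> integral {-(b / 2)..b / 2} g"
  proof (intro integral_le integrable_continuous_interval continuous_intros cg)
    fix x assume "x \<in> {- (b / 2)..b / 2}"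
    then have "\<bar>x / b\<bar> \<le> 1 / 2" using b by (auto simp: field_simps abs_le_iff)
    then have "\<bar>x / b\<bar>\<^sup>2 \<le> (1 / 2)\<^sup>2" by (intro power_mono) auto
    then have "3 / 4 \<le> 1 - (x / b)\<^sup>2" by (simp add: power2_eq_square)
    then have "\<bar>poly (pderiv P) x\<bar> * (3 / 4) \<le> g x"
      unfolding g_def by (intro mult_left_mono) auto
    then show "3 / 4 * \<bar>poly (pderiv P) x\<bar> \<le> g x" by (simp add: mult.commute)
  qed
  also have "\<dots> \<le> integral {-b..b} g"
  proof (intro integral_subset_le integrable_continuous_interval cg ballI)
    fix x assume "x \<in> {-b..b}"
    then have "\<bar>x / b\<bar> \<le> 1" using b by (auto simp: field_simps abs_le_iff)
    then have "(x / b)\<^sup>2 \<le> 1" by (simp add: abs_square_le_1)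
    then show "0 \<le> g x" unfolding g_def by simp
  qed (use b in auto)
  also have "\<dots> = b / 2 * integral {0..2 * pi} (\<lambda>t. \<bar>sin t\<bar> * g (b * cos t))"
    using subst b by (simp add: integral_unique)
  also have "\<dots> \<le> b / 2 * integral {0..2 * pi} (\<lambda>t. 1 / b * (\<bar>T' t\<bar> + \<bar>T t\<bar>))"
    using b gT subst
    by (intro mult_left_mono integral_le integrable_continuous_interval continuous_intros continuous_on_compose2[OF cg[of UNIV]] cT) auto
  also have "\<dots> = 1 / 2 * (integral {0..2 * pi} (\<lambda>t. \<bar>T' t\<bar>) + integral {0..2 * pi} (\<lambda>t. \<bar>T t\<bar>))"
    using b by (simp add: integral_add integrable_continuous_interval continuous_on_rabs cT)
  also have "\<dots> \<le> 1 / 2 * ((3 * real D + 4) * integral {0..2 * pi} (\<lambda>t. \<bar>T t\<bar>))"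
    using IT' by (simp add: algebra_simps)
  also have "\<dots> = (3 * real D + 4) / b * integral {-b..b} (\<lambda>x. \<bar>poly P x\<bar>)"
    unfolding IT by simp
  finally show ?thesis using b by (simp add: field_simps)
qed

subsection \<open>Riemann sums and the Taylor polynomials of the Gaussian\<close>

text \<open>The error is relative to exp(-u), as a decaying weight demands. The Lagrange remainder
  is at most e^u u^N / N!. From 8 u \<le> N and N^N \<le> e^N N! one gets u^N / N! \<le> (e/8)^N
  \<le> e^(-N), and N \<ge> 2u + 1 leaves e^(-u-1) \<le> e^(-u) / 2.\<close>

lemma exp_minus_taylor_error:
  fixes u B :: real
  assumes u: "0 \<le> u" "u \<le> B" and N: "real N \<ge> 8 * B + 1"
  shows "\<bar>exp (- u) - (\<Sum>k<N. (- u) ^ k / fact k)\<bar> \<le> exp (- u) / 2"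
proof -
  have B: "B \<ge> 0" using u by linarith
  have N1: "real N \<ge> 1" "N > 0" using N B by (auto intro: Nat.gr0I)
  obtain t where t: "\<bar>t\<bar> \<le> \<bar>- u\<bar>" "exp (- u) = (\<Sum>k<N. (- u) ^ k / fact k) + exp t / fact N * (- u) ^ N"
    using Maclaurin_exp_le[of "- u" N] by blast
  have "exp (real N) \<ge> real N ^ N / fact N"
  proof -
    have "(\<Sum>k\<in>{N}. real N ^ k /\<^sub>R fact k) \<le> exp (real N)"
      unfolding exp_def by (intro sum_le_suminf summable_exp_generic) auto
    then show ?thesis by (simp add: divide_inverse mult.commute)
  qed
  then have "real N ^ N \<le> exp (real N) * fact N"
    by (simp add: field_simps)
  moreover have "(8 * u) ^ N \<le> real N ^ N"
    using u N by (intro power_mono) auto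
  ultimately have "8 ^ N * u ^ N \<le> exp (real N) * fact N"
    by (simp add: power_mult_distrib)
  \<comment> \<open>The constant 8 is taken so that e^2 \<le> 8: one factor e pays for N^N \<le> e^N
    N!, the other provides the decay e^(-N).\<close>
  moreover have "exp (2 * real N) \<le> 8 ^ N"
  proof -
    have "exp (2::real) = exp 1 * exp 1" by (simp flip: exp_add)
    also have "\<dots> \<le> 272 / 100 * (272 / 100)"
      using e_less_272 by (intro mult_mono) auto
    finally have "exp (2::real) \<le> 8" by simp
    then have "exp 2 ^ N \<le> (8::real) ^ N" by (intro power_mono) auto
    then show ?thesis by (simp flip: exp_of_nat2_mult)
  qed
  then have "exp (2 * real N) * u ^ N \<le> 8 ^ N * u ^ N"
    using u by (intro mult_right_mono) auto
  ultimately have "exp (2 * real N) * u ^ N \<le> exp (real N) * fact N" by linarith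
  moreover have "exp (2 * real N) = exp (real N) * exp (real N)"
    by (simp flip: exp_add)
  ultimately have "exp (real N) * (exp (real N) * u ^ N) \<le> exp (real N) * fact N"
    by (simp add: mult.assoc)
  then have "exp (real N) * u ^ N \<le> fact N" by (simp only: mult_le_cancel_left_pos exp_gt_zero)
  then have un: "u ^ N / fact N \<le> exp (- real N)"
    by (simp add: exp_minus field_simps)
  have "exp (1::real) \<ge> 2" using exp_ge_add_one_self[of "1::real"] by simp
  then have e1: "exp (- 1) \<le> (1 / 2 :: real)" by (simp add: exp_minus field_simps)
  have "\<bar>exp (- u) - (\<Sum>k<N. (- u) ^ k / fact k)\<bar> = exp t * (u ^ N / fact N)"
    unfolding t(2) using u by (simp add: abs_mult power_abs)
  also have "\<dots> \<le> exp u * exp (- real N)"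
    using t(1) u un by (intro mult_mono) auto
  also have "\<dots> \<le> exp u * exp (- (2 * u) - 1)"
    using N u B by (intro mult_left_mono) auto
  also have "\<dots> = exp (- u) * exp (- 1)"
    by (simp flip: exp_add)
  also have "\<dots> \<le> exp (- u) * (1 / 2)"
    by (intro mult_left_mono e1) auto
  finally show ?thesis by simp
qed

text \<open>The Taylor polynomial at u = x^2. A degree of order b^2 is enough for relative accuracy
  1/2, so Gaussian and polynomial are comparable pointwise on [-b, b].\<close>

lemma gaussian_poly_approximation:
  assumes N: "real N \<ge> 8 * b\<^sup>2 + 1"
  shows "\<exists>S :: real poly. degree S \<le> 2 * N \<and>
    (\<forall>x. \<bar>x\<bar> \<le> b \<longrightarrow> \<bar>exp (- x\<^sup>2) - poly S x\<bar> \<le> exp (- x\<^sup>2) / 2)"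
proof (intro exI conjI allI impI)
  define S :: "real poly" where "S = (\<Sum>k<N. monom ((- 1) ^ k / fact k) (2 * k))"
  show "degree S \<le> 2 * N"
    unfolding S_def by (intro degree_sum_le) (auto intro: order_trans[OF degree_monom_le])
  fix x :: real assume "\<bar>x\<bar> \<le> b"
  then have "x\<^sup>2 \<le> b\<^sup>2" by (metis abs_ge_zero power2_abs power_mono)
  then have "\<bar>exp (- x\<^sup>2) - (\<Sum>k<N. (- x\<^sup>2) ^ k / fact k)\<bar> \<le> exp (- x\<^sup>2) / 2"
    using N by (intro exp_minus_taylor_error) auto
  also have "(\<Sum>k<N. (- x\<^sup>2) ^ k / fact k) = poly S x"
    unfolding S_def poly_sum poly_monom
    by (intro sum.cong refl) (simp add: power_mult power_minus[of "x\<^sup>2"])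
  finally show "\<bar>exp (- x\<^sup>2) - poly S x\<bar> \<le> exp (- x\<^sup>2) / 2" .
qed

lemma left_riemann_term:
  fixes P :: "real poly"
  assumes uv: "u \<le> v"
  shows "integral {u..v} (\<lambda>x. \<bar>poly P x\<bar>) \<le>
     (v - u) * \<bar>poly P u\<bar> + (v - u) * integral {u..v} (\<lambda>x. \<bar>poly (pderiv P) x\<bar>)"
proof -
  let ?I = "integral {u..v} (\<lambda>x. \<bar>poly (pderiv P) x\<bar>)"
  have int: "(\<lambda>x. \<bar>poly Q x\<bar>) integrable_on {s..t}" for Q :: "real poly" and s t
    by (intro integrable_continuous_interval continuous_intros)
  have "integral {u..v} (\<lambda>x. \<bar>poly P x\<bar>) \<le> integral {u..v} (\<lambda>x. \<bar>poly P u\<bar> + ?I)"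
  proof (intro integral_le int)
    fix x assume x: "x \<in> {u..v}"
    have "(poly (pderiv P) has_integral (poly P x - poly P u)) {u..x}"
      using x by (intro fundamental_theorem_of_calculus)
        (auto simp: has_real_derivative_iff_has_vector_derivative[symmetric] intro: DERIV_subset poly_DERIV)
    then have "poly P x - poly P u = integral {u..x} (poly (pderiv P))" "poly (pderiv P) integrable_on {u..x}"
      by (auto simp: integral_unique has_integral_integrable)
    then have "\<bar>poly P x - poly P u\<bar> \<le> integral {u..x} (\<lambda>x. \<bar>poly (pderiv P) x\<bar>)"
      using integral_norm_bound_integral[of "poly (pderiv P)" "{u..x}" "\<lambda>x. \<bar>poly (pderiv P) x\<bar>"] int
      by simp
    also have "\<dots> \<le> ?I"
      using x by (intro integral_subset_le int) auto
    finally show "\<bar>poly P x\<bar> \<le> \<bar>poly P u\<bar> + ?I" by linarith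
  qed auto
  also have "\<dots> = (v - u) * \<bar>poly P u\<bar> + (v - u) * ?I"
    using uv by (simp add: algebra_simps)
  finally show ?thesis .
qed

text \<open>Left endpoints are used because node k carries the gap to its right. The claim
  \<open>y l \<le> y m\<close> is proved along with the estimate, since the induction needs it to
  split the integrals at \<open>y m\<close>.\<close>

lemma left_riemann_sum:
  fixes P :: "real poly" and y :: "nat \<Rightarrow> real"
  assumes lm: "l \<le> m"
      and mono: "\<And>k. l \<le> k \<Longrightarrow> k < m \<Longrightarrow> y k \<le> y (k + 1)"
      and gap: "\<And>k. l \<le> k \<Longrightarrow> k < m \<Longrightarrow> y (k + 1) - y k \<le> \<delta>"
  shows "y l \<le> y m \<and> integral {y l..y m} (\<lambda>x. \<bar>poly P x\<bar>) \<le>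
     (\<Sum>k=l..<m. (y (k + 1) - y k) * \<bar>poly P (y k)\<bar>) + \<delta> * integral {y l..y m} (\<lambda>x. \<bar>poly (pderiv P) x\<bar>)"
  using lm mono gap
proof (induction m rule: dec_induct)
  case base
  then show ?case by simp
next
  case (step m)
  have int: "(\<lambda>x. \<bar>poly Q x\<bar>) integrable_on {s..t}" for Q :: "real poly" and s t
    by (intro integrable_continuous_interval continuous_intros)
  have IH: "y l \<le> y m" "integral {y l..y m} (\<lambda>x. \<bar>poly P x\<bar>) \<le>
     (\<Sum>k=l..<m. (y (k + 1) - y k) * \<bar>poly P (y k)\<bar>) + \<delta> * integral {y l..y m} (\<lambda>x. \<bar>poly (pderiv P) x\<bar>)"
    using step.IH step.prems by auto
  have ym: "y m \<le> y (Suc m)" "y (Suc m) - y m \<le> \<delta>" using step.prems[of m] step.hyps by auto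
  have split: "integral {y l..y (Suc m)} (\<lambda>x. \<bar>poly Q x\<bar>) =
      integral {y l..y m} (\<lambda>x. \<bar>poly Q x\<bar>) + integral {y m..y (Suc m)} (\<lambda>x. \<bar>poly Q x\<bar>)" for Q :: "real poly"
    by (rule Henstock_Kurzweil_Integration.integral_combine[symmetric]) (use IH ym int in auto)
  have "integral {y m..y (Suc m)} (\<lambda>x. \<bar>poly P x\<bar>) \<le> (y (Suc m) - y m) * \<bar>poly P (y m)\<bar> +
      (y (Suc m) - y m) * integral {y m..y (Suc m)} (\<lambda>x. \<bar>poly (pderiv P) x\<bar>)"
    by (rule left_riemann_term[OF ym(1)])
  also have "(y (Suc m) - y m) * integral {y m..y (Suc m)} (\<lambda>x. \<bar>poly (pderiv P) x\<bar>) \<le>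
      \<delta> * integral {y m..y (Suc m)} (\<lambda>x. \<bar>poly (pderiv P) x\<bar>)"
    by (intro mult_right_mono ym integral_nonneg int) auto
  finally show ?case using IH ym step.hyps unfolding split by (simp add: algebra_simps)
qed

subsection \<open>Restricted range inequality\<close>

lemma cauchy_bound_circle:
  fixes f :: "complex \<Rightarrow> complex"
  assumes f: "f holomorphic_on UNIV" and r: "0 \<le> r" "r < 1"
  shows "2 * pi * norm (f (of_real r)) \<le> 1 / (1 - r) * integral {0..2 * pi} (\<lambda>t. norm (f (cis t)))"
proof -
  let ?w = "complex_of_real r"
  have "((\<lambda>u. f u / (u - ?w)) has_contour_integral (2 * of_real pi * \<i> * f ?w)) (part_circlepath 0 1 0 (2 * pi))"
    using Cauchy_integral_circlepath_simple[of f 0 1 ?w] f r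
    by (auto simp: circlepath_def intro: holomorphic_on_subset)
  then have "((\<lambda>t. f (0 + of_real 1 * cis t) / (0 + of_real 1 * cis t - ?w) * of_real 1 * \<i> * cis t) has_integral (2 * of_real pi * \<i> * f ?w)) {0..2 * pi}"
    by (subst (asm) has_contour_integral_part_circlepath_iff) auto
  then have I: "((\<lambda>t. f (cis t) / (cis t - ?w) * \<i> * cis t) has_integral (2 * of_real pi * \<i> * f ?w)) {0..2 * pi}"
    by simp
  have cf: "continuous_on UNIV f" using f by (rule holomorphic_on_imp_continuous_on)
  have "norm (2 * of_real pi * \<i> * f ?w) \<le> integral {0..2 * pi} (\<lambda>t. 1 / (1 - r) * norm (f (cis t)))"
    unfolding integral_unique[OF I, symmetric]
  proof (rule integral_norm_bound_integral)
    show "(\<lambda>t. f (cis t) / (cis t - ?w) * \<i> * cis t) integrable_on {0..2 * pi}"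
      using I by blast
    show "(\<lambda>t. 1 / (1 - r) * norm (f (cis t))) integrable_on {0..2 * pi}"
      by (intro integrable_continuous_interval continuous_intros continuous_on_compose2[OF cf]) auto
    fix t :: real
    have "1 - r \<le> norm (cis t - ?w)"
      using norm_triangle_ineq2[of "cis t" ?w] r by simp
    then show "norm (f (cis t) / (cis t - ?w) * \<i> * cis t) \<le> 1 / (1 - r) * norm (f (cis t))"
      using r by (simp add: norm_mult norm_divide frac_le)
  qed
  then show ?thesis by (simp add: norm_mult)
qed

text \<open>The Mhaskar-Rakhmanov-Saff argument in a hands-on form. Under \<open>x = a / 2 * (z + 1 / z)\<close> the weight
  \<open>exp (- x\<^sup>2)\<close> has, on the unit circle, the same modulus as the entire function
  \<open>exp (- a\<^sup>2 * (1 + z\<^sup>2) / 2)\<close>; so Cauchy's formula in the disc bounds the weighted polynomial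
  outside \<open>[-a, a]\<close> by its integral over \<open>[-a, a]\<close>. The factor \<open>1 - z\<^sup>2\<close> is the Jacobian.\<close>

lemma weighted_poly_bound_outside_joukowski:
  fixes R :: "real poly"
  assumes R: "degree R \<le> m" and a: "a > 0" "a\<^sup>2 = real m + 2" and r: "0 < r" "r < 1"
      and x: "x = a / 2 * (r + 1 / r)"
  shows "\<bar>exp (- x\<^sup>2) * poly R x\<bar> \<le>
     exp (- (a\<^sup>2 * (ln r + ((1 / r)\<^sup>2 - r\<^sup>2) / 4))) / (2 * pi * (x - a)) *
     integral {-a..a} (\<lambda>x. \<bar>exp (- x\<^sup>2) * poly R x\<bar>)"
proof -
  define I where "I = integral {-a..a} (\<lambda>x. \<bar>exp (- x\<^sup>2) * poly R x\<bar>)"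
  have I0: "I \<ge> 0" unfolding I_def by (rule integral_nonneg) (auto intro!: integrable_continuous_interval continuous_intros)
  define Rc :: "complex poly" where "Rc = map_poly of_real R"
  have "degree Rc \<le> m" unfolding Rc_def using R by (intro degree_le) (auto simp: coeff_map_poly coeff_eq_0)
  then obtain p where p: "\<And>z. z \<noteq> 0 \<Longrightarrow> poly p z = z ^ m * poly Rc (of_real (a / 2) * (z + 1 / z))"
    using joukowski_poly by blast
  define f where "f z = poly p z * (1 - z\<^sup>2) * exp (- of_real (a\<^sup>2 / 2) * z\<^sup>2)" for z :: complex
  have f: "f holomorphic_on UNIV" unfolding f_def by (intro holomorphic_intros)
  have nf: "norm (f (cis t)) = 2 * exp (a\<^sup>2 / 2) * (\<bar>sin t\<bar> * \<bar>exp (- (a * cos t)\<^sup>2) * poly R (a * cos t)\<bar>)" for t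
  proof -
    have "1 / cis t = cis (- t)" by (simp add: divide_inverse)
    then have "of_real (a / 2) * (cis t + 1 / cis t) = complex_of_real (a * cos t)"
      by (simp only:) (simp add: complex_eq_iff)
    then have 1: "norm (poly p (cis t)) = \<bar>poly R (a * cos t)\<bar>"
      using p[of "cis t"] by (simp add: Rc_def poly_map_of_real norm_mult norm_power del: of_real_mult)
    have "1 - (cis t)\<^sup>2 = - (2 * \<i> * of_real (sin t) * cis t)"
      using sin_cos_squared_add[of t] by (auto simp: complex_eq_iff power2_eq_square)
    then have 2: "norm (1 - (cis t)\<^sup>2) = 2 * \<bar>sin t\<bar>" by (simp add: norm_mult)
    \<comment> \<open>The identity cos 2t = 2 cos^2 t - 1 turns the entire exponential into the
      weight at x = a cos t, up to the constant exp(a^2 / 2).\<close>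
    have "Re (- of_real (a\<^sup>2 / 2) * (cis t)\<^sup>2) = - (a\<^sup>2 / 2) * cos (2 * t)"
      by (simp add: Complex.DeMoivre)
    also have "\<dots> = a\<^sup>2 / 2 + - (a * cos t)\<^sup>2"
      by (simp only: cos_double_cos) (simp add: algebra_simps power_mult_distrib)
    finally have 3: "norm (exp (- of_real (a\<^sup>2 / 2) * (cis t)\<^sup>2)) = exp (a\<^sup>2 / 2) * exp (- (a * cos t)\<^sup>2)"
      unfolding norm_exp_eq_Re by (simp only: exp_add)
    show ?thesis unfolding f_def norm_mult 1 2 3 by (simp add: abs_mult)
  qed
  have "((\<lambda>t. \<bar>sin t\<bar> * \<bar>exp (- (a * cos t)\<^sup>2) * poly R (a * cos t)\<bar>) has_integral 2 / a * I) {0..2 * pi}"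
    unfolding I_def
    by (intro has_integral_joukowski_substitution[where g = "\<lambda>x. \<bar>exp (- x\<^sup>2) * poly R x\<bar>"] a continuous_intros)
  then have If: "integral {0..2 * pi} (\<lambda>t. norm (f (cis t))) = 4 / a * exp (a\<^sup>2 / 2) * I"
    unfolding nf by (simp add: integral_unique)
  have 1: "of_real (a / 2) * (of_real r + 1 / of_real r) = complex_of_real x"
    unfolding x by simp
  have "norm (poly p (of_real r)) = r ^ m * \<bar>poly R x\<bar>"
    using p[of "of_real r"] r unfolding 1 by (simp add: Rc_def poly_map_of_real norm_mult norm_power)
  moreover have "norm (1 - (complex_of_real r)\<^sup>2) = 1 - r\<^sup>2"
  proof -
    have "r\<^sup>2 \<le> 1" using r by (simp add: power_le_one)
    moreover have "1 - (complex_of_real r)\<^sup>2 = of_real (1 - r\<^sup>2)" by simp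
    ultimately show ?thesis by (metis norm_of_real abs_of_nonneg diff_ge_0_iff_ge)
  qed
  moreover have "norm (exp (- complex_of_real (a\<^sup>2 / 2) * (of_real r)\<^sup>2)) = exp (- (a\<^sup>2 / 2 * r\<^sup>2))"
    by (simp add: norm_exp_eq_Re flip: of_real_power)
  ultimately have fr: "norm (f (of_real r)) = r ^ m * \<bar>poly R x\<bar> * (1 - r\<^sup>2) * exp (- (a\<^sup>2 / 2 * r\<^sup>2))"
    unfolding f_def norm_mult by simp
  have main: "2 * pi * (r ^ m * \<bar>poly R x\<bar> * (1 - r\<^sup>2) * exp (- (a\<^sup>2 / 2 * r\<^sup>2))) \<le> 1 / (1 - r) * (4 / a * exp (a\<^sup>2 / 2) * I)"
    using cauchy_bound_circle[OF f, of r] r unfolding If fr by simp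
  define E where "E = exp (- (a\<^sup>2 * (ln r + ((1 / r)\<^sup>2 - r\<^sup>2) / 4)))"
  have x2: "x\<^sup>2 = a\<^sup>2 / 4 * (r\<^sup>2 + 2 + (1 / r)\<^sup>2)"
    unfolding x using r by (simp add: power_mult_distrib power2_sum power_divide)
  have xa: "x - a = a / 2 * (1 - r)\<^sup>2 / r"
    unfolding x using r by (simp add: field_simps power2_eq_square)
  have xa0: "x - a > 0" unfolding xa using r a by simp
  \<comment> \<open>Here \<open>a\<^sup>2 = m + 2\<close> enters: r^(m+2) joins the other
    exponentials in \<open>E\<close>. Of the two powers of r beyond m, one cancels against the
    factor r in the identity for (1 - r^2)(1 - r) a, the other is removed by 2r \<le> 1 + r.\<close>
  have rm: "r ^ (m + 2) = exp (a\<^sup>2 * ln r)"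
  proof -
    have "r ^ (m + 2) = exp (ln r) ^ (m + 2)" using r by simp
    also have "\<dots> = exp (real (m + 2) * ln r)" by (simp only: exp_of_nat_mult)
    finally show ?thesis by (simp add: a(2) add.commute)
  qed
  have E: "exp (- x\<^sup>2) * (exp (a\<^sup>2 / 2) * exp (a\<^sup>2 / 2 * r\<^sup>2)) = E * r ^ (m + 2)"
    unfolding rm E_def x2 by (simp flip: exp_add) (simp add: field_simps)
  have "\<bar>poly R x\<bar> * (r ^ m * (2 * pi * (1 - r\<^sup>2) * (1 - r) * a)) \<le> 4 * (exp (a\<^sup>2 / 2) * exp (a\<^sup>2 / 2 * r\<^sup>2)) * I"
    using main r a by (simp add: exp_minus field_simps)
  then have "exp (- x\<^sup>2) * (\<bar>poly R x\<bar> * (r ^ m * (2 * pi * (1 - r\<^sup>2) * (1 - r) * a))) \<le> exp (- x\<^sup>2) * (4 * (exp (a\<^sup>2 / 2) * exp (a\<^sup>2 / 2 * r\<^sup>2)) * I)"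
    by (intro mult_left_mono) auto
  also have "\<dots> = 4 * (E * r ^ (m + 2)) * I"
    unfolding E[symmetric] by simp
  finally have "r ^ m * (exp (- x\<^sup>2) * \<bar>poly R x\<bar> * (2 * pi * (1 - r\<^sup>2) * (1 - r) * a)) \<le> r ^ m * (4 * E * r\<^sup>2 * I)"
    by (simp add: power_add power2_eq_square mult_ac)
  then have "exp (- x\<^sup>2) * \<bar>poly R x\<bar> * (2 * pi * (1 - r\<^sup>2) * (1 - r) * a) \<le> 4 * E * r\<^sup>2 * I"
    using r by (simp only: mult_le_cancel_left_pos zero_less_power)
  also have "(1 - r\<^sup>2) * (1 - r) * a = (x - a) * (2 * r * (1 + r))"
    unfolding xa using r by (simp add: field_simps power2_eq_square)
  then have "2 * pi * (1 - r\<^sup>2) * (1 - r) * a = 2 * pi * (x - a) * (2 * r * (1 + r))"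
    by (simp add: mult.assoc)
  finally have le: "exp (- x\<^sup>2) * \<bar>poly R x\<bar> * (2 * pi * (x - a) * (2 * r * (1 + r))) \<le> 4 * E * r\<^sup>2 * I" .
  have e1: "4 * E * r\<^sup>2 * I = (2 * r) * (E * I * (2 * r))" by (simp add: power2_eq_square)
  have e2: "exp (- x\<^sup>2) * \<bar>poly R x\<bar> * (2 * pi * (x - a) * (2 * r * (1 + r))) =
      (2 * r) * (exp (- x\<^sup>2) * \<bar>poly R x\<bar> * (2 * pi * (x - a)) * (1 + r))"
    by (simp only: mult_ac)
  have "(2 * r) * (exp (- x\<^sup>2) * \<bar>poly R x\<bar> * (2 * pi * (x - a)) * (1 + r)) \<le> (2 * r) * (E * I * (2 * r))"
    using le unfolding e1 e2 .
  then have "exp (- x\<^sup>2) * \<bar>poly R x\<bar> * (2 * pi * (x - a)) * (1 + r) \<le> E * I * (2 * r)"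
    by (rule mult_left_le_imp_le) (use r in simp)
  also have "\<dots> \<le> E * I * (1 + r)"
    using r I0 by (intro mult_left_mono) (auto simp: E_def)
  finally have "exp (- x\<^sup>2) * \<bar>poly R x\<bar> * (2 * pi * (x - a)) \<le> E * I"
    by (rule mult_right_le_imp_le) (use r in simp)
  then show ?thesis
    unfolding E_def[symmetric] I_def[symmetric] using xa0 by (simp add: abs_mult pos_le_divide_eq)
qed

text \<open>\<open>K\<close> vanishes at a and has derivative 2 sqrt(x^2 - a^2), so it is
  nonnegative and convex to the right of a. The bound is its tangent at A with the term K(A) \<ge> 0
  dropped. \<open>K\<close> is the exponent of the Joukowski estimate written in terms of x.\<close>

lemma exterior_exponent_lower_bound:
  fixes a A x :: real
  defines "K \<equiv> \<lambda>x. x * sqrt (x\<^sup>2 - a\<^sup>2) - a\<^sup>2 * ln ((x + sqrt (x\<^sup>2 - a\<^sup>2)) / a)"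
  assumes a: "a > 0" and A: "a < A" "A \<le> x"
  shows "K x \<ge> 2 * sqrt (A\<^sup>2 - a\<^sup>2) * (x - A)"
proof -
  have sq: "t\<^sup>2 - a\<^sup>2 > 0" if "t > a" for t using that a by (simp add: power_strict_mono)
  \<comment> \<open>The derivative formula is available only to the right of \<open>a\<close>, so
    comparing K(a) with K(A) needs continuity up to the endpoint.\<close>
  have cK: "continuous_on {a..} K"
  proof -
    have "t + sqrt (t\<^sup>2 - a\<^sup>2) > 0" if "t \<ge> a" for t
      using that a by (intro add_pos_nonneg) (auto simp: power_mono)
    then show ?thesis unfolding K_def using a
      by (intro continuous_intros) fastforce+
  qed
  have dK: "(K has_real_derivative 2 * sqrt (t\<^sup>2 - a\<^sup>2)) (at t)" if t: "t > a" for t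
  proof -
    define s where "s = sqrt (t\<^sup>2 - a\<^sup>2)"
    have s: "s > 0" "s\<^sup>2 = t\<^sup>2 - a\<^sup>2" using sq[OF t] by (auto simp: s_def)
    have ts: "t + s > 0" using s t a by linarith
    have "(K has_real_derivative (s + t * (t / s) - a\<^sup>2 * ((1 + t / s) / (t + s)))) (at t)"
    proof -
      have ds: "((\<lambda>t. sqrt (t\<^sup>2 - a\<^sup>2)) has_real_derivative t / s) (at t)"
        using sq[OF t] by (auto intro!: derivative_eq_intros simp: s_def field_simps)
      have "((\<lambda>t. (t + sqrt (t\<^sup>2 - a\<^sup>2)) / a) has_real_derivative (1 + t / s) / a) (at t)"
        by (intro DERIV_cdivide DERIV_add DERIV_ident ds)
      moreover have "(t + sqrt (t\<^sup>2 - a\<^sup>2)) / a > 0" using ts a by (simp add: s_def)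
      ultimately have "((\<lambda>t. ln ((t + sqrt (t\<^sup>2 - a\<^sup>2)) / a)) has_real_derivative 1 / ((t + sqrt (t\<^sup>2 - a\<^sup>2)) / a) * ((1 + t / s) / a)) (at t)"
        by (rule DERIV_chain2[OF DERIV_ln_divide, rotated])
      also have "(t + sqrt (t\<^sup>2 - a\<^sup>2)) / a = (t + s) / a" by (simp add: s_def)
      also have "1 / ((t + s) / a) * ((1 + t / s) / a) = (1 + t / s) / (t + s)"
        using a by simp
      finally have dl: "((\<lambda>t. ln ((t + sqrt (t\<^sup>2 - a\<^sup>2)) / a)) has_real_derivative (1 + t / s) / (t + s)) (at t)" .
      show ?thesis
        unfolding K_def
        using DERIV_diff[OF DERIV_mult[OF DERIV_ident ds] DERIV_cmult[OF dl, of "a\<^sup>2"]]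
        by (simp add: s_def add.commute mult.commute)
    qed
    also have "s + t * (t / s) - a\<^sup>2 * ((1 + t / s) / (t + s)) = 2 * s"
    proof -
      have "1 + t / s = (t + s) / s" using s by (simp add: add_divide_distrib)
      then have "(1 + t / s) / (t + s) = 1 / s" using ts by simp
      then have "s + t * (t / s) - a\<^sup>2 * ((1 + t / s) / (t + s)) = s + (t\<^sup>2 - a\<^sup>2) / s"
        by (simp add: power2_eq_square diff_divide_distrib)
      also have "\<dots> = 2 * s" unfolding s(2)[symmetric] by (simp add: power2_eq_square)
      finally show ?thesis .
    qed
    finally show ?thesis unfolding s_def .
  qed
  have "K a \<le> K A"
  proof (rule DERIV_nonneg_imp_increasing_open[where f = K])
    fix t assume "a < t" "t < A"
    then show "\<exists>y. (K has_real_derivative y) (at t) \<and> 0 \<le> y"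
      using dK[of t] sq[of t] by (intro exI[of _ "2 * sqrt (t\<^sup>2 - a\<^sup>2)"]) auto
  qed (use A cK in \<open>auto intro: continuous_on_subset\<close>)
  then have KA: "K A \<ge> 0" using a by (simp add: K_def)
  have "K A - 2 * sqrt (A\<^sup>2 - a\<^sup>2) * A \<le> K x - 2 * sqrt (A\<^sup>2 - a\<^sup>2) * x"
  proof (rule DERIV_nonneg_imp_nondecreasing[OF A(2), where f = "\<lambda>t. K t - 2 * sqrt (A\<^sup>2 - a\<^sup>2) * t"])
    fix t assume t: "A \<le> t" "t \<le> x"
    then have "A\<^sup>2 \<le> t\<^sup>2" using a A by (intro power_mono) auto
    then show "\<exists>y. ((\<lambda>t. K t - 2 * sqrt (A\<^sup>2 - a\<^sup>2) * t) has_real_derivative y) (at t) \<and> 0 \<le> y"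
      using t A by (intro exI[of _ "2 * sqrt (t\<^sup>2 - a\<^sup>2) - 2 * sqrt (A\<^sup>2 - a\<^sup>2)"])
        (auto intro!: derivative_eq_intros dK)
  qed
  then show ?thesis using KA by (simp add: algebra_simps)
qed

lemma integrable_gaussian_poly: "integrable lborel (\<lambda>x. exp (- x\<^sup>2) * poly R x)" for R :: "real poly"
proof -
  have mono: "integrable lborel (\<lambda>x::real. exp (- x\<^sup>2) * x ^ k)" for k
  proof -
    \<comment> \<open>Variance 1/2 makes the normal density equal to exp(-x^2) / sqrt pi.\<close>
    have "integrable lborel (\<lambda>x. sqrt pi * (normal_density 0 (sqrt (1 / 2)) x * (x - 0) ^ k))"
      by (intro integrable_mult_right integrable_normal_moment) auto
    moreover have "sqrt pi * (normal_density 0 (sqrt (1 / 2)) x * (x - 0) ^ k) = exp (- x\<^sup>2) * x ^ k" for x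
      by (simp add: normal_density_def)
    ultimately show ?thesis by (simp only:)
  qed
  have "integrable lborel (\<lambda>x. \<Sum>k\<le>degree R. coeff R k * (exp (- x\<^sup>2) * x ^ k))"
    by (intro Bochner_Integration.integrable_sum integrable_mult_right mono)
  then show ?thesis
    by (simp add: poly_altdef sum_distrib_left mult_ac)
qed

text \<open>Inverting the Joukowski map expresses the previous bound through x; the tangent bound
  for the exponent and x - a \<ge> A - a then give an exponential that can be integrated
  explicitly.\<close>

lemma weighted_poly_bound_outside:
  fixes R :: "real poly"
  assumes R: "degree R \<le> m" and a: "a > 0" "a\<^sup>2 = real m + 2" and A: "a < A" "A \<le> x"
  shows "\<bar>exp (- x\<^sup>2) * poly R x\<bar> \<le>
     integral {-a..a} (\<lambda>x. \<bar>exp (- x\<^sup>2) * poly R x\<bar>) / (2 * pi * (A - a)) * exp (- (2 * sqrt (A\<^sup>2 - a\<^sup>2) * (x - A)))"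
proof -
  define I where "I = integral {-a..a} (\<lambda>x. \<bar>exp (- x\<^sup>2) * poly R x\<bar>)"
  have I0: "I \<ge> 0" unfolding I_def by (rule integral_nonneg) (auto intro!: integrable_continuous_interval continuous_intros)
  define s where "s = sqrt (x\<^sup>2 - a\<^sup>2)"
  \<comment> \<open>The root inside the unit disc of x = (a/2)(r + 1/r); the other root is (x +
    s)/a.\<close>
  define r where "r = (x - s) / a"
  have xa: "x > a" using A by simp
  have "x\<^sup>2 - a\<^sup>2 > 0" using xa a(1) by (simp add: power_strict_mono)
  then have s: "s > 0" "s\<^sup>2 = x\<^sup>2 - a\<^sup>2" by (auto simp: s_def)
  have prod: "(x - s) * (x + s) = a\<^sup>2" using s(2) by (simp add: algebra_simps power2_eq_square)
  have xs: "x + s > 0" using xa a s by linarith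
  then have xs': "x - s > 0" using prod a by (metis zero_less_mult_pos2 zero_less_power)
  have ir: "1 / r = (x + s) / a"
    unfolding r_def using prod a xs' by (simp add: field_simps power2_eq_square)
  have "1 / r > 1" unfolding ir using a s xa by simp
  moreover have "r > 0" unfolding r_def using xs' a by simp
  ultimately have r: "0 < r" "r < 1" by (simp_all add: field_simps)
  have xr: "x = a / 2 * (r + 1 / r)"
    unfolding ir unfolding r_def using a by (simp add: field_simps)
  have lnr: "ln r = - ln ((x + s) / a)"
    unfolding ir[symmetric] using r by (simp add: ln_div)
  have "(1 / r)\<^sup>2 - r\<^sup>2 = ((x + s)\<^sup>2 - (x - s)\<^sup>2) / a\<^sup>2"
    unfolding ir unfolding r_def by (simp only: power_divide diff_divide_distrib[symmetric])
  also have "\<dots> = 4 * x * s / a\<^sup>2" by (simp add: power2_eq_square algebra_simps)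
  finally have "a\<^sup>2 * (ln r + ((1 / r)\<^sup>2 - r\<^sup>2) / 4) = x * s - a\<^sup>2 * ln ((x + s) / a)"
    unfolding lnr using a by (simp add: field_simps)
  moreover have "x * s - a\<^sup>2 * ln ((x + s) / a) \<ge> 2 * sqrt (A\<^sup>2 - a\<^sup>2) * (x - A)"
    using exterior_exponent_lower_bound[OF a(1) A] by (simp add: s_def)
  ultimately have "exp (- (a\<^sup>2 * (ln r + ((1 / r)\<^sup>2 - r\<^sup>2) / 4))) \<le> exp (- (2 * sqrt (A\<^sup>2 - a\<^sup>2) * (x - A)))"
    by simp
  then have "exp (- (a\<^sup>2 * (ln r + ((1 / r)\<^sup>2 - r\<^sup>2) / 4))) / (2 * pi * (x - a)) \<le> exp (- (2 * sqrt (A\<^sup>2 - a\<^sup>2) * (x - A))) / (2 * pi * (A - a))"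
    using A by (intro frac_le) auto
  then have "exp (- (a\<^sup>2 * (ln r + ((1 / r)\<^sup>2 - r\<^sup>2) / 4))) / (2 * pi * (x - a)) * I \<le> exp (- (2 * sqrt (A\<^sup>2 - a\<^sup>2) * (x - A))) / (2 * pi * (A - a)) * I"
    by (intro mult_right_mono I0)
  with weighted_poly_bound_outside_joukowski[OF R a r xr]
  show ?thesis unfolding I_def[symmetric] by (simp add: mult_ac)
qed

lemma weighted_poly_tail:
  fixes R :: "real poly"
  assumes R: "degree R \<le> m" and a: "a > 0" "a\<^sup>2 = real m + 2" and A: "a < A"
  shows "(LINT x|lborel. indicator {A..} x * \<bar>exp (- x\<^sup>2) * poly R x\<bar>) \<le>
     integral {-a..a} (\<lambda>x. \<bar>exp (- x\<^sup>2) * poly R x\<bar>) / (4 * pi * ((A - a) * sqrt (A\<^sup>2 - a\<^sup>2)))"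
proof -
  define I where "I = integral {-a..a} (\<lambda>x. \<bar>exp (- x\<^sup>2) * poly R x\<bar>)"
  define c where "c = 2 * sqrt (A\<^sup>2 - a\<^sup>2)"
  have c: "c > 0" unfolding c_def using A a(1) by (simp add: power_strict_mono)
  define K where "K = I / (2 * pi * (A - a))"
  have "((\<lambda>x. exp (- c * x)) has_integral exp (- c * A) / c) {A..}"
    by (rule has_integral_exp_minus_to_infinity[OF c])
  from has_integral_mult_right[OF this, of "K * exp (c * A)"]
  have "((\<lambda>x. K * exp (c * A) * exp (- c * x)) has_integral K / c) {A..}"
    by (simp add: exp_minus field_simps)
  then have 1: "((\<lambda>x. if x \<in> {A..} then K * exp (c * A) * exp (- c * x) else 0) has_integral K / c) UNIV"
    by (simp only: has_integral_restrict_UNIV)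
  have "integrable lborel (\<lambda>x. indicator {A..} x *\<^sub>R \<bar>exp (- x\<^sup>2) * poly R x\<bar>)"
    by (intro integrable_mult_indicator integrable_abs integrable_gaussian_poly) auto
  then have 2: "((\<lambda>x. indicator {A..} x * \<bar>exp (- x\<^sup>2) * poly R x\<bar>) has_integral (LINT x|lborel. indicator {A..} x * \<bar>exp (- x\<^sup>2) * poly R x\<bar>)) UNIV"
    unfolding real_scaleR_def by (rule has_integral_integral_lborel)
  have "(LINT x|lborel. indicator {A..} x * \<bar>exp (- x\<^sup>2) * poly R x\<bar>) \<le> K / c"
  proof (rule has_integral_le[OF 2 1])
    fix x :: real
    show "indicator {A..} x * \<bar>exp (- x\<^sup>2) * poly R x\<bar> \<le> (if x \<in> {A..} then K * exp (c * A) * exp (- c * x) else 0)"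
    proof (cases "x \<in> {A..}")
      case True
      have "exp (c * A) * exp (- c * x) = exp (- (c * (x - A)))"
        unfolding exp_add[symmetric] by (simp add: algebra_simps)
      then have "K * exp (c * A) * exp (- c * x) = K * exp (- (c * (x - A)))" by simp
      then show ?thesis
        using weighted_poly_bound_outside[OF R a A, of x] True
        by (simp only: K_def I_def c_def) simp
    qed simp
  qed
  then show ?thesis unfolding K_def c_def I_def by (simp add: field_simps)
qed

text \<open>Each tail is at most 1/(4 pi) \<le> 1/6 of the integral over [-A, A], the left one by
  reflecting x \<mapsto> -x. Together they add at most one third.\<close>

lemma weighted_poly_restricted_range:
  fixes R :: "real poly"
  assumes R: "degree R \<le> m" and a: "a > 0" "a\<^sup>2 = real m + 2"
      and A: "a < A" "(A - a) * sqrt (A\<^sup>2 - a\<^sup>2) \<ge> 1"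
  shows "(LINT x|lborel. \<bar>exp (- x\<^sup>2) * poly R x\<bar>) \<le> 4 / 3 * integral {-A..A} (\<lambda>x. \<bar>exp (- x\<^sup>2) * poly R x\<bar>)"
proof -
  define G where "G x = \<bar>exp (- x\<^sup>2) * poly R x\<bar>" for x
  define J where "J = integral {-A..A} G"
  have cG: "continuous_on S G" for S unfolding G_def by (intro continuous_intros)
  have iG: "integrable lborel G" unfolding G_def by (intro integrable_abs integrable_gaussian_poly)
  have iGi: "integrable lborel (\<lambda>x. indicator S x * G x)" if "S \<in> sets borel" for S
    using integrable_mult_indicator[of S lborel G] iG that by simp
  have le: "integral {-a..a} G \<le> J"
    unfolding J_def by (intro integral_subset_le integrable_continuous_interval cG) (use A in \<open>auto simp: G_def\<close>)
  have J0: "J \<ge> 0" unfolding J_def by (intro integral_nonneg integrable_continuous_interval cG) (auto simp: G_def)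
  have "4 * pi * 1 \<le> 4 * pi * ((A - a) * sqrt (A\<^sup>2 - a\<^sup>2))" using A(2) by (intro mult_left_mono) auto
  moreover have "12 < 4 * pi" using pi_gt3 by simp
  ultimately have big: "4 * pi * ((A - a) * sqrt (A\<^sup>2 - a\<^sup>2)) \<ge> 6" by linarith
  have *: "integral {-a..a} G / (4 * pi * ((A - a) * sqrt (A\<^sup>2 - a\<^sup>2))) \<le> J / 6"
    using big le J0 by (intro frac_le) auto
  have right: "(LINT x|lborel. indicator {A..} x * G x) \<le> J / 6"
    using weighted_poly_tail[OF R a A(1)] * unfolding G_def by linarith
  have left: "(LINT x|lborel. indicator {..-A} x * G x) \<le> J / 6"
  proof -
    define R' where "R' = pcompose R [:0, -1:]"
    have R': "poly R' x = poly R (- x)" for x unfolding R'_def by (simp add: poly_pcompose)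
    have "degree R' \<le> m" using R unfolding R'_def by (simp add: degree_pcompose)
    have "(LINT x|lborel. indicator {..-A} x * G x) = (LINT x|lborel. indicator {A..} x * G (- x))"
      using lborel_integral_real_affine[of "-1" "\<lambda>x. indicator {..-A} x * G x" 0]
      by (simp add: indicator_def)
    also have "\<dots> \<le> integral {-a..a} (\<lambda>x. G (- x)) / (4 * pi * ((A - a) * sqrt (A\<^sup>2 - a\<^sup>2)))"
      using weighted_poly_tail[OF \<open>degree R' \<le> m\<close> a A(1)] unfolding R' G_def by simp
    also have "integral {-a..a} (\<lambda>x. G (- x)) = integral {-a..a} G"
      using Henstock_Kurzweil_Integration.integral_reflect_real[of a "-a" G] by simp
    finally show ?thesis using * by linarith
  qed
  have mid: "(LINT x|lborel. indicator {-A..A} x * G x) = J"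
    using set_borel_integral_eq_integral(2)[of "{-A..A}" G] iGi[of "{-A..A}"]
    unfolding J_def set_integrable_def set_lebesgue_integral_def by simp
  \<comment> \<open>The three pieces overlap at A and -A, hence an inequality.\<close>
  have "(LINT x|lborel. G x) \<le> (LINT x|lborel. (indicator {-A..A} x * G x + indicator {A..} x * G x) + indicator {..-A} x * G x)"
    by (intro integral_mono iG iGi Bochner_Integration.integrable_add) (auto simp: indicator_def G_def)
  also have "\<dots> = J + (LINT x|lborel. indicator {A..} x * G x) + (LINT x|lborel. indicator {..-A} x * G x)"
    unfolding mid[symmetric] by (simp add: iGi)
  finally show ?thesis using left right unfolding J_def G_def by linarith
qed

subsection \<open>Point masses\<close>

text \<open>As the image under \<open>y\<close> of a point measure on the finite index set, it has
  measures and integrals that reduce to finite sums.\<close>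

definition weighted_points :: "nat \<Rightarrow> (nat \<Rightarrow> real) \<Rightarrow> (nat \<Rightarrow> real) \<Rightarrow> real measure" where
  "weighted_points M w y = distr (point_measure {1..M} (\<lambda>k. ennreal (w k))) borel y"

lemma emeasure_weighted_points:
  assumes B: "B \<in> sets borel" and w: "\<And>k. k \<in> {1..M} \<Longrightarrow> w k \<ge> 0"
  shows "emeasure (weighted_points M w y) B = ennreal (\<Sum>k=1..M. w k * indicator B (y k))"
proof -
  have "emeasure (weighted_points M w y) B = emeasure (point_measure {1..M} (\<lambda>k. ennreal (w k))) {k\<in>{1..M}. y k \<in> B}"
    unfolding weighted_points_def using B
    by (subst emeasure_distr) (auto simp: measurable_point_measure_eq1 space_point_measure intro!: arg_cong[where f = "emeasure _"])
  also have "\<dots> = (\<Sum>k\<in>{k\<in>{1..M}. y k \<in> B}. ennreal (w k))"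
    by (rule emeasure_point_measure_finite) auto
  also have "\<dots> = ennreal (\<Sum>k\<in>{k\<in>{1..M}. y k \<in> B}. w k)"
    using w by (intro sum_ennreal) auto
  also have "(\<Sum>k\<in>{k\<in>{1..M}. y k \<in> B}. w k) = (\<Sum>k=1..M. w k * indicator B (y k))"
    by (rule sum.mono_neutral_cong_left) (auto simp: indicator_def)
  finally show ?thesis .
qed

text \<open>The supremum over Borel subsets of B is attained at the nodes in B of positive weight.
  Injectivity of \<open>y\<close> prevents weights of opposite sign from cancelling at a common
  node.\<close>

lemma pos_part_measure_point_masses:
  fixes y :: "nat \<Rightarrow> real"
  assumes inj: "inj_on y {1..M}"
  shows "pos_part_measure (\<lambda>B. \<Sum>k=1..M. w k * indicator B (y k)) = weighted_points M (\<lambda>k. max 0 (w k)) y"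
proof -
  let ?\<mu> = "weighted_points M (\<lambda>k. max 0 (w k)) y"
  have sp: "space ?\<mu> = UNIV" "sets ?\<mu> = sets borel" by (auto simp: weighted_points_def)
  have eq: "(SUP A \<in> {A \<in> sets borel. A \<subseteq> B}. ennreal (\<Sum>k=1..M. w k * indicator A (y k))) = emeasure ?\<mu> B"
    if B: "B \<in> sets borel" for B :: "real set"
  proof (rule antisym)
    show "(SUP A \<in> {A \<in> sets borel. A \<subseteq> B}. ennreal (\<Sum>k=1..M. w k * indicator A (y k))) \<le> emeasure ?\<mu> B"
    proof (rule SUP_least)
      fix A assume A: "A \<in> {A \<in> sets borel. A \<subseteq> B}"
      then show "ennreal (\<Sum>k=1..M. w k * indicator A (y k)) \<le> emeasure ?\<mu> B"
        unfolding emeasure_weighted_points[OF B max.cobounded1]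
        by (intro ennreal_leI sum_mono) (auto simp: indicator_def)
    qed
    let ?A = "B \<inter> y ` {k\<in>{1..M}. w k > 0}"
    have "?A \<in> {A \<in> sets borel. A \<subseteq> B}" using B by (auto intro!: sets.Int borel_closed finite_imp_closed)
    moreover have "emeasure ?\<mu> B = ennreal (\<Sum>k=1..M. w k * indicator ?A (y k))"
      unfolding emeasure_weighted_points[OF B max.cobounded1]
    proof (intro arg_cong[where f = ennreal] sum.cong refl)
      fix k assume k: "k \<in> {1..M}"
      have "y k \<in> y ` {k\<in>{1..M}. w k > 0} \<longleftrightarrow> w k > 0"
        by (subst inj_on_image_mem_iff[OF inj k]) (use k in auto)
      then show "max 0 (w k) * indicator B (y k) = w k * indicator ?A (y k)"
        by (auto simp: indicator_def max_def)
    qed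
    ultimately show "emeasure ?\<mu> B \<le> (SUP A \<in> {A \<in> sets borel. A \<subseteq> B}. ennreal (\<Sum>k=1..M. w k * indicator A (y k)))"
      by (intro SUP_upper2) auto
  qed
  have ss: "sigma_sets UNIV (sets borel) = sets (borel :: real measure)"
    using sets.sigma_sets_eq[of "borel :: real measure"] by simp
  have "pos_part_measure (\<lambda>B. \<Sum>k=1..M. w k * indicator B (y k)) = measure_of UNIV (sets borel) (emeasure ?\<mu>)"
    unfolding pos_part_measure_def using ss
    by (intro measure_of_eq) (auto simp only: ss eq)
  also have "\<dots> = ?\<mu>" using measure_of_of_measure[of ?\<mu>] by (simp add: sp)
  finally show ?thesis .
qed

lemma weighted_points_integral:
  fixes f :: "real \<Rightarrow> real"
  assumes f: "f \<in> borel_measurable borel" and w: "\<And>k. k \<in> {1..M} \<Longrightarrow> w k \<ge> 0"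
  shows "integrable (weighted_points M w y) f"
    and "(LINT x|weighted_points M w y. f x) = (\<Sum>k=1..M. w k * f (y k))"
proof -
  have y: "y \<in> measurable (point_measure {1..M} (\<lambda>k. ennreal (w k))) borel"
    by (simp add: measurable_point_measure_eq1)
  show "integrable (weighted_points M w y) f"
    unfolding weighted_points_def
    by (subst integrable_distr_eq[OF y f]) (simp add: integrable_point_measure_finite)
  show "(LINT x|weighted_points M w y. f x) = (\<Sum>k=1..M. w k * f (y k))"
    unfolding weighted_points_def integral_distr[OF y f]
    using w by (subst lebesgue_integral_point_measure_finite) auto
qed

lemma signed_integral_point_masses:
  fixes f :: "real \<Rightarrow> real" and y :: "nat \<Rightarrow> real"
  assumes inj: "inj_on y {1..M}" and f: "f \<in> borel_measurable borel"
  shows "signed_integrable (\<lambda>B. \<Sum>k=1..M. w k * indicator B (y k)) f"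
    and "signed_integral (\<lambda>B. \<Sum>k=1..M. w k * indicator B (y k)) f = (\<Sum>k=1..M. w k * f (y k))"
proof -
  have neg: "(\<lambda>B. - (\<Sum>k=1..M. w k * indicator B (y k))) = (\<lambda>B. \<Sum>k=1..M. (- w k) * indicator B (y k))"
    by (simp add: sum_negf)
  show "signed_integrable (\<lambda>B. \<Sum>k=1..M. w k * indicator B (y k)) f"
    unfolding signed_integrable_def neg pos_part_measure_point_masses[OF inj]
    using weighted_points_integral(1)[OF f] by simp
  have "(\<Sum>k=1..M. max 0 (w k) * f (y k)) - (\<Sum>k=1..M. max 0 (- w k) * f (y k)) = (\<Sum>k=1..M. w k * f (y k))"
    unfolding sum_subtractf[symmetric] by (intro sum.cong) (auto simp: max_def)
  then show "signed_integral (\<lambda>B. \<Sum>k=1..M. w k * indicator B (y k)) f = (\<Sum>k=1..M. w k * f (y k))"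
    unfolding signed_integral_def neg pos_part_measure_point_masses[OF inj]
    by (simp add: weighted_points_integral(2)[OF f])
qed

lemma gen_integral_point_masses:
  fixes f :: "real \<Rightarrow> real" and y :: "nat \<Rightarrow> real"
  assumes inj: "inj_on y {1..M}" and f: "f \<in> borel_measurable borel"
  shows "gen_integrable (point_masses M w y) f"
    and "gen_integral (point_masses M w y) f = of_real (\<Sum>k=1..M. w k * f (y k))"
proof -
  \<comment> \<open>The imaginary part is handled as point masses of weight 0.\<close>
  have zero: "(\<lambda>B. 0) = (\<lambda>B. \<Sum>k=1..M. (0::real) * indicator B (y k))" by simp
  show "gen_integrable (point_masses M w y) f"
    using signed_integral_point_masses(1)[OF inj f, of w] signed_integral_point_masses(1)[OF inj f, of "\<lambda>_. 0"]
    by (simp add: point_masses_def)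
  show "gen_integral (point_masses M w y) f = of_real (\<Sum>k=1..M. w k * f (y k))"
    using signed_integral_point_masses(2)[OF inj f, of w] signed_integral_point_masses(2)[OF inj f, of "\<lambda>_. 0"]
    by (simp add: point_masses_def complex_eq_iff del: of_real_sum)
qed

lemma sums_indicator_disjoint_family:
  assumes "disjoint_family A"
  shows "(\<lambda>i. indicator (A i) x :: real) sums indicator (\<Union>i. A i) x"
proof (cases "\<exists>i. x \<in> A i")
  case True
  then obtain i where i: "x \<in> A i" by blast
  have "indicator (A j) x = (if j = i then 1 else 0 :: real)" for j
    using assms i by (auto simp: disjoint_family_on_def indicator_def)
  moreover have "indicator (\<Union>i. A i) x = (1 :: real)" using i by (auto simp: indicator_def)
  ultimately show ?thesis using sums_single[of i "\<lambda>_. 1 :: real"] by simp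
next
  case False
  then show ?thesis by (auto simp: indicator_def)
qed

lemma is_gen_measure_point_masses: "is_gen_measure (point_masses M w y)"
  unfolding point_masses_def is_gen_measure.simps complex_measure_def
  by (intro allI impI sums_of_real sums_sum sums_mult sums_indicator_disjoint_family)

text \<open>On each piece of a partition the triangle inequality passes to the weights
  \<open>\<bar>w k\<bar>\<close>, which are countably additive.\<close>

lemma total_variation_point_masses_le:
  "total_variation (point_masses M w y) B \<le> ennreal (\<Sum>k=1..M. \<bar>w k\<bar> * indicator B (y k))"
  unfolding point_masses_def total_variation.simps
proof (rule SUP_least)
  fix A :: "nat \<Rightarrow> real set"
  assume "A \<in> {A. range A \<subseteq> sets borel \<and> disjoint_family A \<and> (\<Union>i. A i) = B}"
  then have A: "disjoint_family A" "(\<Union>i. A i) = B" by auto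
  define g where "g i = (\<Sum>k=1..M. \<bar>w k\<bar> * indicator (A i) (y k))" for i
  have s: "g sums (\<Sum>k=1..M. \<bar>w k\<bar> * indicator (\<Union>i. A i) (y k))"
    unfolding g_def by (intro sums_sum sums_mult sums_indicator_disjoint_family A)
  have g0: "g i \<ge> 0" for i unfolding g_def by (intro sum_nonneg) auto
  have "(\<Sum>i. ennreal (norm (complex_of_real (\<Sum>k=1..M. w k * indicator (A i) (y k))))) \<le> (\<Sum>i. ennreal (g i))"
  proof (intro suminf_le ennreal_leI)
    fix i
    show "norm (complex_of_real (\<Sum>k=1..M. w k * indicator (A i) (y k))) \<le> g i"
      unfolding g_def norm_of_real
      by (rule order_trans[OF sum_abs], rule sum_mono) (simp add: abs_mult)
  qed auto
  also have "\<dots> = ennreal (\<Sum>k=1..M. \<bar>w k\<bar> * indicator B (y k))"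
    using suminf_ennreal_eq[OF g0 s] A by simp
  finally show "(\<Sum>i. ennreal (norm (complex_of_real (\<Sum>k=1..M. w k * indicator (A i) (y k))))) \<le> ennreal (\<Sum>k=1..M. \<bar>w k\<bar> * indicator B (y k))" .
qed

text \<open>The gaps whose left end lies in [u, v] do not overlap and stay within [u, v + \<delta>].
  The minimum with the last node strengthens the claim enough for the induction on M.\<close>

lemma sum_gaps_le:
  fixes y :: "nat \<Rightarrow> real"
  assumes mono: "\<And>k. 1 \<le> k \<Longrightarrow> k \<le> M \<Longrightarrow> y k \<le> y (k + 1)"
      and gap: "\<And>k. 1 \<le> k \<Longrightarrow> k \<le> M \<Longrightarrow> y (k + 1) - y k \<le> \<delta>"
  shows "(\<Sum>k=1..M. (y (k + 1) - y k) * indicator {u..v} (y k)) \<le> max 0 (min (y (M + 1)) (v + \<delta>) - u)"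
  using assms
proof (induction M)
  case 0
  then show ?case by simp
next
  case (Suc M)
  have IH: "(\<Sum>k=1..M. (y (k + 1) - y k) * indicator {u..v} (y k)) \<le> max 0 (min (y (M + 1)) (v + \<delta>) - u)"
    using Suc by auto
  have st: "y (M + 1) \<le> y (M + 2)" "y (M + 2) - y (M + 1) \<le> \<delta>" using Suc.prems[of "M + 1"] by auto
  show ?case
  proof (cases "y (M + 1) \<in> {u..v}")
    case True
    then show ?thesis using IH st by (auto simp: min_def max_def split: if_splits)
  next
    case False
    then show ?thesis using IH st by (auto simp: min_def max_def split: if_splits)
  qed
qed

text \<open>Gaps that start in [x - r, x + r] have total length at most 2r + 1/n, because the last
  one may overshoot by 1/n. This is at most 2 (r + 1/n), so the supremum is at most 2c.\<close>

lemma point_masses_in_MZ: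
  assumes n: "n > 0" and c: "c \<ge> 0"
      and mono: "strict_mono_on {1..M + 1} y"
      and gap: "\<And>k. 1 \<le> k \<Longrightarrow> k \<le> M \<Longrightarrow> y (k + 1) - y k \<le> 1 / n"
      and w: "\<And>k. 1 \<le> k \<Longrightarrow> k \<le> M \<Longrightarrow> \<bar>w k\<bar> \<le> c * (y (k + 1) - y k)"
      and quad: "\<And>P Q. P \<in> weighted_polys n \<Longrightarrow> Q \<in> weighted_polys n \<Longrightarrow>
         (LINT t|lborel. P t * Q t) = (\<Sum>k = 1..M. w k * P (y k) * Q (y k))"
  shows "point_masses M w y \<in> MZ n"
proof -
  have inj: "inj_on y {1..M}"
    using strict_mono_on_imp_inj_on[OF mono] by (rule inj_on_subset) auto
  have mono': "y k \<le> y (k + 1)" if "1 \<le> k" "k \<le> M" for k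
    using strict_mono_onD[OF mono, of k "k + 1"] that by simp
  have meas: "P \<in> borel_measurable borel" if "P \<in> weighted_polys n" for P
    using that unfolding weighted_polys_def
    by (auto intro!: borel_measurable_continuous_onI continuous_intros)
  have tv: "total_variation (point_masses M w y) {x - r..x + r} / ennreal (r + 1 / n) \<le> ennreal (2 * c)"
    if r: "r > 0" for x r
  proof -
    have "(\<Sum>k=1..M. \<bar>w k\<bar> * indicator {x - r..x + r} (y k)) \<le>
        (\<Sum>k=1..M. c * ((y (k + 1) - y k) * indicator {x - r..x + r} (y k)))"
      using w by (intro sum_mono) (auto simp: indicator_def)
    also have "\<dots> = c * (\<Sum>k=1..M. (y (k + 1) - y k) * indicator {x - r..x + r} (y k))"
      by (simp only: sum_distrib_left)
    also have "\<dots> \<le> c * max 0 (min (y (M + 1)) (x + r + 1 / n) - (x - r))"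
      by (intro mult_left_mono sum_gaps_le mono' gap c)
    also have "\<dots> \<le> c * (2 * (r + 1 / n))"
    proof (intro mult_left_mono c max.boundedI)
      have "1 / n > 0" using n by simp
      moreover have "min (y (M + 1)) (x + r + 1 / n) \<le> x + r + 1 / n" by (rule min.cobounded2)
      ultimately show "min (y (M + 1)) (x + r + 1 / n) - (x - r) \<le> 2 * (r + 1 / n)" by argo
    qed (use r n in simp)
    finally have "total_variation (point_masses M w y) {x - r..x + r} \<le> ennreal (2 * c * (r + 1 / n))"
      using total_variation_point_masses_le[of M w y "{x - r..x + r}"]
      by (intro order_trans[OF total_variation_point_masses_le] ennreal_leI) (simp add: mult_ac)
    then have "total_variation (point_masses M w y) {x - r..x + r} / ennreal (r + 1 / n) \<le> ennreal (2 * c * (r + 1 / n)) / ennreal (r + 1 / n)"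
      by (rule divide_right_mono_ennreal)
    also have "\<dots> = ennreal (2 * c)"
    proof -
      have "r + 1 / n > 0" using r n by (simp add: add_pos_pos)
      then show ?thesis using c by (subst divide_ennreal) auto
    qed
    finally show ?thesis .
  qed
  have "(SUP x. SUP r \<in> {0<..}. total_variation (point_masses M w y) {x - r..x + r} / ennreal (r + 1 / n)) \<le> ennreal (2 * c)"
    using tv by (intro SUP_least) auto
  then have "(SUP x. SUP r \<in> {0<..}. total_variation (point_masses M w y) {x - r..x + r} / ennreal (r + 1 / n)) < top"
    by (rule le_less_trans) simp
  then show ?thesis
    unfolding MZ_def
    using is_gen_measure_point_masses[of M w y] gen_integral_point_masses[OF inj borel_measurable_times[OF meas meas], of _ _ w] quad
    by (simp add: mult.assoc)
qed

subsection \<open>The quadrature formula\<close>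

text \<open>One Hahn-Banach step. By homogeneity only vectors with p v = 1 matter, and there w has
  to lie between all L v - N v and all L u + N u. For two such vectors p (v - u) = 0, so the
  domination of L at v - u puts the first below the second.\<close>

lemma functional_split_off:
  fixes L p N :: "real poly \<Rightarrow> real" and V :: "real poly set"
  assumes V_add: "\<And>u v. u \<in> V \<Longrightarrow> v \<in> V \<Longrightarrow> u + v \<in> V"
      and V_smult: "\<And>c u. u \<in> V \<Longrightarrow> smult c u \<in> V"
      and L_add: "\<And>u v. u \<in> V \<Longrightarrow> v \<in> V \<Longrightarrow> L (u + v) = L u + L v"
      and L_smult: "\<And>c u. u \<in> V \<Longrightarrow> L (smult c u) = c * L u"
      and p_add: "\<And>u v. u \<in> V \<Longrightarrow> v \<in> V \<Longrightarrow> p (u + v) = p u + p v"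
      and p_smult: "\<And>c u. u \<in> V \<Longrightarrow> p (smult c u) = c * p u"
      and N_add: "\<And>u v. u \<in> V \<Longrightarrow> v \<in> V \<Longrightarrow> N (u + v) \<le> N u + N v"
      and N_smult: "\<And>c u. u \<in> V \<Longrightarrow> N (smult c u) = \<bar>c\<bar> * N u"
      and s: "s \<ge> 0"
      and L_le: "\<And>v. v \<in> V \<Longrightarrow> L v \<le> s * \<bar>p v\<bar> + N v"
  shows "\<exists>w. \<bar>w\<bar> \<le> s \<and> (\<forall>v\<in>V. L v - w * p v \<le> N v)"
proof (cases "\<exists>v\<in>V. p v \<noteq> 0")
  case False
  then show ?thesis using s L_le by (intro exI[of _ 0]) fastforce
next
  case True
  define T where "T = {v\<in>V. p v = 1}"
  obtain v0 where v0: "v0 \<in> V" "p v0 \<noteq> 0" using True by blast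
  then have "smult (1 / p v0) v0 \<in> T" unfolding T_def by (simp add: V_smult p_smult)
  then have T_ne: "T \<noteq> {}" by blast
  have sep: "L v - N v \<le> L u + N u" if "v \<in> T" "u \<in> T" for u v
  proof -
    have uv: "u \<in> V" "v \<in> V" "p u = 1" "p v = 1" using that by (auto simp: T_def)
    let ?d = "v + smult (-1) u"
    have "L ?d \<le> s * \<bar>p ?d\<bar> + N ?d" by (intro L_le V_add V_smult uv)
    also have "p ?d = 1 + (-1) * 1" using uv by (simp only: p_add p_smult V_smult)
    also have "N ?d \<le> N v + N (smult (-1) u)" by (intro N_add V_smult uv)
    also have "N (smult (-1) u) = N u" using N_smult[of u "-1"] uv by simp
    also have "L ?d = L v - L u" using uv by (simp only: L_add L_smult V_smult)
    finally show ?thesis using uv by simp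
  qed
  have upper: "L v - N v \<le> s" if "v \<in> T" for v
    using L_le[of v] that by (simp add: T_def)
  have lower: "- s \<le> L u + N u" if "u \<in> T" for u
    using L_le[of "smult (-1) u"] L_smult[of u "-1"] N_smult[of u "-1"] p_smult[of u "-1"] V_smult[of u "-1"] that
    by (simp add: T_def)
  have bdd: "bdd_above ((\<lambda>v. L v - N v) ` T)" using upper by (intro bdd_aboveI2) auto
  define w where "w = max (- s) (SUP v\<in>T. L v - N v)"
  have w1: "L v - N v \<le> w" if "v \<in> T" for v
    unfolding w_def using cSUP_upper[OF that bdd] by linarith
  have w2: "w \<le> L u + N u" if "u \<in> T" for u
    unfolding w_def using lower[OF that] sep that T_ne by (auto intro!: cSUP_least)
  have "w \<le> s" unfolding w_def using s upper T_ne by (auto intro!: cSUP_least)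
  then have "\<bar>w\<bar> \<le> s" unfolding w_def by linarith
  moreover have "L v - w * p v \<le> N v" if v: "v \<in> V" for v
  proof (cases "p v = 0")
    case True then show ?thesis using L_le[OF v] by simp
  next
    case False
    let ?c = "p v" and ?u = "smult (1 / p v) v"
    have T: "?u \<in> T" unfolding T_def using False v by (simp add: V_smult p_smult)
    have Lu: "L ?u = L v / ?c" "N ?u = N v / \<bar>?c\<bar>" using v by (auto simp: L_smult N_smult)
    show ?thesis
    proof (cases "?c > 0")
      case True
      then show ?thesis using w1[OF T] unfolding Lu by (simp add: field_simps)
    next
      case neg: False
      then show ?thesis using w2[OF T] False unfolding Lu by (simp add: field_simps)
    qed
  qed
  ultimately show ?thesis by blast
qed

text \<open>A finite form of the Hahn-Banach extension theorem: the weights are found one node at a time.\<close>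

lemma functional_eq_sum_of_dominated:
  fixes L :: "real poly \<Rightarrow> real" and p :: "'i \<Rightarrow> real poly \<Rightarrow> real" and V :: "real poly set"
  assumes fin: "finite K"
      and V_add: "\<And>u v. u \<in> V \<Longrightarrow> v \<in> V \<Longrightarrow> u + v \<in> V"
      and V_smult: "\<And>c u. u \<in> V \<Longrightarrow> smult c u \<in> V"
      and p_add: "\<And>k u v. u \<in> V \<Longrightarrow> v \<in> V \<Longrightarrow> p k (u + v) = p k u + p k v"
      and p_smult: "\<And>k c u. u \<in> V \<Longrightarrow> p k (smult c u) = c * p k u"
      and L_add: "\<And>u v. u \<in> V \<Longrightarrow> v \<in> V \<Longrightarrow> L (u + v) = L u + L v"
      and L_smult: "\<And>c u. u \<in> V \<Longrightarrow> L (smult c u) = c * L u"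
      and s: "\<And>k. k \<in> K \<Longrightarrow> s k \<ge> 0"
      and L_le: "\<And>v. v \<in> V \<Longrightarrow> L v \<le> (\<Sum>k\<in>K. s k * \<bar>p k v\<bar>)"
  shows "\<exists>w. (\<forall>k\<in>K. \<bar>w k\<bar> \<le> s k) \<and> (\<forall>v\<in>V. L v = (\<Sum>k\<in>K. w k * p k v))"
  using fin L_add L_smult s L_le
proof (induction K arbitrary: L rule: finite_induct)
  case empty
  \<comment> \<open>The domination says L \<le> 0 on a space closed under negation.\<close>
  have "L v = 0" if "v \<in> V" for v
    using empty(4)[OF that] empty(4)[of "smult (-1) v"] empty(2)[of v "-1"] V_smult[OF that, of "-1"] that by simp
  then show ?case by simp
next
  case (insert k K)
  define N where "N v = (\<Sum>k\<in>K. s k * \<bar>p k v\<bar>)" for v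
  have N_add: "N (u + v) \<le> N u + N v" if "u \<in> V" "v \<in> V" for u v
    unfolding N_def sum.distrib[symmetric]
    by (intro sum_mono) (use that insert.prems(3) in \<open>auto simp: p_add simp flip: distrib_left intro!: mult_left_mono\<close>)
  have N_smult: "N (smult c u) = \<bar>c\<bar> * N u" if "u \<in> V" for c u
    unfolding N_def sum_distrib_left using that by (intro sum.cong) (auto simp: p_smult abs_mult)
  have "\<exists>w. \<bar>w\<bar> \<le> s k \<and> (\<forall>v\<in>V. L v - w * p k v \<le> N v)"
    by (rule functional_split_off)
       (use insert V_add V_smult p_add p_smult N_add N_smult in \<open>auto simp: N_def\<close>)
  then obtain a where a: "\<bar>a\<bar> \<le> s k" "\<And>v. v \<in> V \<Longrightarrow> L v - a * p k v \<le> N v" by blast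
  have "\<exists>w. (\<forall>k\<in>K. \<bar>w k\<bar> \<le> s k) \<and> (\<forall>v\<in>V. L v - a * p k v = (\<Sum>k\<in>K. w k * p k v))"
    by (rule insert.IH[of "\<lambda>v. L v - a * p k v"])
       (use insert.prems a(2) in \<open>auto simp: N_def p_add p_smult algebra_simps\<close>)
  then obtain w where w: "\<forall>j\<in>K. \<bar>w j\<bar> \<le> s j" "\<forall>v\<in>V. L v - a * p k v = (\<Sum>k\<in>K. w k * p k v)" by blast
  show ?case
  proof (intro exI[of _ "w(k := a)"] conjI ballI)
    fix v assume "v \<in> V"
    then have "L v = a * p k v + (\<Sum>j\<in>K. w j * p j v)" using w(2) by (simp add: algebra_simps)
    also have "(\<Sum>j\<in>K. w j * p j v) = (\<Sum>j\<in>K. (w(k := a)) j * p j v)"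
      using insert.hyps by (intro sum.cong) auto
    finally show "L v = (\<Sum>j\<in>insert k K. (w(k := a)) j * p j v)" using insert.hyps by simp
  qed (use w a insert.hyps in auto)
qed

text \<open>With q = n^(-1/3) one has A = sqrt 2 (n + 2q). One q absorbs the +2 in a^2 = 2d + 2,
  giving a \<le> sqrt 2 (n + q); the other remains as the distance A - a \<ge> sqrt 2 q. Then (A -
  a)^2 (A^2 - a^2) \<ge> 4 q^3 n = 4, so the exponent -1/3 is the one that makes this independent of
  n, and C = 2 suffices.\<close>

lemma mrs_interval_estimates:
  fixes n A a :: real and d :: nat
  assumes n: "n \<ge> 1" and d: "real d < n\<^sup>2"
      and A: "A = n * sqrt 2 * (1 + 2 * n powr (- 4 / 3))" and a: "a = sqrt (2 * real d + 2)"
  shows "a < A" "(A - a) * sqrt (A\<^sup>2 - a\<^sup>2) \<ge> 1" "A \<le> 9 / 2 * n"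
proof -
  define q where "q = n powr (- 1 / 3)"
  have q: "q > 0" "q \<le> 1" using n powr_mono[of "- 1 / 3" 0 n] by (auto simp: q_def)
  have "n * n powr (- 4 / 3) = n powr 1 * n powr (- 4 / 3)" using n by simp
  also have "\<dots> = q" unfolding q_def powr_add[symmetric] by simp
  finally have Aq: "A = sqrt 2 * (n + 2 * q)" unfolding A by (simp add: algebra_simps)
  have nq: "n * q \<ge> 1"
  proof -
    have "n * q = n powr 1 * n powr (- 1 / 3)" using n by (simp add: q_def)
    also have "\<dots> = n powr (2 / 3)" unfolding powr_add[symmetric] by simp
    also have "\<dots> \<ge> 1" using n by (intro ge_one_powr_ge_zero) auto
    finally show ?thesis .
  qed
  have q3: "q ^ 3 * n = 1"
  proof -
    have "q ^ 3 * n = n powr (- 1) * n" unfolding q_def using n by (simp add: powr_power)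
    then show ?thesis using n by (simp add: powr_minus)
  qed
  have a0: "a \<ge> 0" unfolding a by simp
  have "2 * real d + 2 \<le> 2 * (n + q)\<^sup>2"
  proof -
    have "(n + q)\<^sup>2 = n\<^sup>2 + q\<^sup>2 + 2 * (n * q)" by (simp add: power2_sum)
    then show ?thesis using d nq zero_le_power2[of q] by linarith
  qed
  then have "a \<le> sqrt (2 * (n + q)\<^sup>2)" unfolding a by (rule real_sqrt_le_mono)
  also have "\<dots> = sqrt 2 * (n + q)" using n q by (simp add: real_sqrt_mult)
  finally have Aa: "A - a \<ge> sqrt 2 * q" unfolding Aq by (simp add: algebra_simps)
  then show "a < A" using q by (smt (verit) mult_pos_pos real_sqrt_gt_zero)
  have Aa': "A + a \<ge> sqrt 2 * n" unfolding Aq using a0 q by (simp add: algebra_simps)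
  have "A\<^sup>2 - a\<^sup>2 = (A - a) * (A + a)" by (simp add: power2_eq_square algebra_simps)
  also have "\<dots> \<ge> (sqrt 2 * q) * (sqrt 2 * n)"
    using Aa Aa' q n \<open>a < A\<close> by (intro mult_mono) auto
  also have "(sqrt 2 * q) * (sqrt 2 * n) = (sqrt 2 * sqrt 2) * (q * n)" by (simp only: mult_ac)
  also have "\<dots> = 2 * (q * n)" by simp
  finally have s: "A\<^sup>2 - a\<^sup>2 \<ge> 2 * (q * n)" .
  have "(sqrt 2 * q)\<^sup>2 * (2 * (q * n)) \<le> (A - a)\<^sup>2 * (A\<^sup>2 - a\<^sup>2)"
    using Aa s q n by (intro mult_mono power_mono) auto
  moreover have "(sqrt 2 * q)\<^sup>2 * (2 * (q * n)) = 4 * (q ^ 3 * n)"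
    by (simp add: power_mult_distrib power3_eq_cube power2_eq_square)
  ultimately have "(A - a)\<^sup>2 * (A\<^sup>2 - a\<^sup>2) \<ge> 1" unfolding q3 by simp
  moreover have "A\<^sup>2 - a\<^sup>2 \<ge> 0" using s q n by (smt (verit) mult_pos_pos)
  ultimately have "((A - a) * sqrt (A\<^sup>2 - a\<^sup>2))\<^sup>2 \<ge> 1\<^sup>2" by (simp add: power_mult_distrib)
  then show "(A - a) * sqrt (A\<^sup>2 - a\<^sup>2) \<ge> 1"
    by (rule power2_le_imp_le) (use \<open>a < A\<close> \<open>A\<^sup>2 - a\<^sup>2 \<ge> 0\<close> in simp)
  have "sqrt 2 \<le> (3 / 2 :: real)" by (rule real_le_lsqrt) (auto simp: power2_eq_square)
  then have "A \<le> 3 / 2 * (3 * n)" unfolding Aq using q n by (intro mult_mono) auto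
  then show "A \<le> 9 / 2 * n" by simp
qed

text \<open>Take the last node not to the right of -A and the first not to the left of A. The gap
  bound limits the overshoot, which keeps these nodes where the Gaussian is approximated.\<close>

lemma nodes_covering_interval:
  fixes y :: "nat \<Rightarrow> real"
  assumes mono: "strict_mono_on {1..M + 1} y" and A: "A > 0" "y 1 \<le> - A" "A \<le> y (M + 1)"
      and gap: "\<And>k. 1 \<le> k \<Longrightarrow> k \<le> M \<Longrightarrow> y (k + 1) - y k \<le> \<delta>"
  obtains l m where "1 \<le> l" "l \<le> m" "m \<le> M + 1" "y l \<le> - A" "A \<le> y m" "- A - \<delta> \<le> y l" "y m \<le> A + \<delta>"
proof -
  define l where "l = Max {k\<in>{1..M + 1}. y k \<le> - A}"
  define m where "m = Min {k\<in>{1..M + 1}. A \<le> y k}"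
  have l: "l \<in> {k\<in>{1..M + 1}. y k \<le> - A}" unfolding l_def by (rule Max_in) (use A in auto)
  have m: "m \<in> {k\<in>{1..M + 1}. A \<le> y k}" unfolding m_def by (rule Min_in) (use A in auto)
  have "y l < y m" using l m A by auto
  then have lm: "l < m" using l m strict_mono_on_less[OF mono, of l m] by auto
  have "y (l + 1) > - A"
  proof (rule ccontr)
    assume "\<not> y (l + 1) > - A"
    then have "l + 1 \<le> l" unfolding l_def[symmetric] using lm m
      by (subst (2) l_def, intro Max_ge) auto
    then show False by simp
  qed
  moreover have "y (l + 1) - y l \<le> \<delta>" using l m lm by (intro gap) auto
  ultimately have 1: "- A - \<delta> \<le> y l" by linarith
  have "y (m - 1) < A"
  proof (rule ccontr)
    assume "\<not> y (m - 1) < A"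
    then have "m \<le> m - 1" using lm m l
      by (subst m_def, intro Min_le) auto
    then show False using lm by simp
  qed
  moreover have "y (m - 1 + 1) - y (m - 1) \<le> \<delta>" using l m lm by (intro gap) auto
  ultimately have "y m \<le> A + \<delta>" using lm by simp
  with 1 l m lm show thesis by (intro that[of l m]) auto
qed

text \<open>The tail and the derivative term are both estimated by the full integral
  \<open>I\<close>; the constants are arranged so that the resulting multiple of \<open>I\<close>
  can be moved to the left-hand side.\<close>

lemma weighted_poly_integral_le_sum:
  fixes y :: "nat \<Rightarrow> real" and R :: "real poly"
  assumes n: "n \<ge> 1" and d: "real d < n\<^sup>2" and R: "degree R \<le> 2 * d"
      and A: "A = n * sqrt 2 * (1 + 2 * n powr (- 4 / 3))"
      and mono: "strict_mono_on {1..M + 1} y" and yA: "y 1 \<le> - A" "A \<le> y (M + 1)"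
      and gap: "\<And>k. 1 \<le> k \<Longrightarrow> k \<le> M \<Longrightarrow> y (k + 1) - y k \<le> 1 / (10000 * n)"
  shows "(LINT x|lborel. \<bar>exp (- x\<^sup>2) * poly R x\<bar>) \<le>
     (\<Sum>k=1..M. 6 * (y (k + 1) - y k) * \<bar>exp (- (y k)\<^sup>2) * poly R (y k)\<bar>)"
proof -
  define F where "F x = exp (- x\<^sup>2) * poly R x" for x
  define I where "I = (LINT x|lborel. \<bar>F x\<bar>)"
  \<comment> \<open>b / 2 = 5 n has to exceed A + \<delta>, and A \<le> 9/2 n.\<close>
  define b where "b = 10 * n"
  define N where "N = nat \<lceil>8 * b\<^sup>2 + 1\<rceil>"
  define \<delta> where "\<delta> = 1 / (10000 * n)"
  define a where "a = sqrt (2 * real d + 2)"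
  define \<Sigma> where "\<Sigma> = (\<Sum>k=1..M. (y (k + 1) - y k) * \<bar>F (y k)\<bar>)"
  note est = mrs_interval_estimates[OF n d A a_def]
  have b: "b > 0" and n2: "n\<^sup>2 \<ge> 1" using n by (auto simp: b_def)
  have \<delta>: "\<delta> > 0" "\<delta> \<le> n / 10000"
  proof -
    show "\<delta> > 0" using n by (simp add: \<delta>_def)
    have "1 / n \<le> 1" using n by simp
    then have "1 / n \<le> n" using n by linarith
    then show "\<delta> \<le> n / 10000" by (simp add: \<delta>_def)
  qed
  have a0: "a > 0" "a\<^sup>2 = real (2 * d) + 2" unfolding a_def by auto
  have A0: "A > 0" using est(1) a0 by linarith
  have cF: "continuous_on S (\<lambda>x. \<bar>F x\<bar>)" for S unfolding F_def by (intro continuous_intros)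
  have int: "(\<lambda>x. \<bar>poly Q x\<bar>) integrable_on {s..t}" for Q :: "real poly" and s t
    by (intro integrable_continuous_interval continuous_intros)
  have iF: "integrable lborel (\<lambda>x. \<bar>F x\<bar>)" unfolding F_def by (intro integrable_abs integrable_gaussian_poly)
  have I0: "I \<ge> 0" unfolding I_def by simp
  have I_le: "I \<le> 4 / 3 * integral {-A..A} (\<lambda>x. \<bar>F x\<bar>)"
    unfolding I_def F_def by (rule weighted_poly_restricted_range[OF R a0 est(1,2)])
  have N_ge: "real N \<ge> 8 * b\<^sup>2 + 1" unfolding N_def by linarith
  have N_le: "real N \<le> 8 * b\<^sup>2 + 2"
  proof -
    have "8 * b\<^sup>2 + 1 \<ge> 0" by simp
    then show ?thesis unfolding N_def by linarith
  qed
  obtain S :: "real poly" where S: "degree S \<le> 2 * N"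
      "\<And>x. \<bar>x\<bar> \<le> b \<Longrightarrow> \<bar>exp (- x\<^sup>2) - poly S x\<bar> \<le> exp (- x\<^sup>2) / 2"
    using gaussian_poly_approximation[OF N_ge] by blast
  define P where "P = R * S"
  have degP: "degree P \<le> 2 * d + 2 * N"
    unfolding P_def using degree_mult_le[of R S] R S(1) by linarith
  \<comment> \<open>Accuracy 1/2 places the polynomial between one half and 3/2 of the Gaussian in
    modulus; multiplying by R gives both comparisons.\<close>
  have P_F: "\<bar>poly P x\<bar> \<le> 3 / 2 * \<bar>F x\<bar>" "\<bar>F x\<bar> \<le> 2 * \<bar>poly P x\<bar>" if "\<bar>x\<bar> \<le> b" for x
  proof -
    have s: "\<bar>poly S x\<bar> \<le> 3 / 2 * exp (- x\<^sup>2)" "exp (- x\<^sup>2) \<le> 2 * \<bar>poly S x\<bar>"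
      using S(2)[OF that] by (auto simp: abs_if split: if_splits)
    show "\<bar>poly P x\<bar> \<le> 3 / 2 * \<bar>F x\<bar>"
      using mult_left_mono[OF s(1), of "\<bar>poly R x\<bar>"] by (simp add: P_def F_def abs_mult mult_ac)
    show "\<bar>F x\<bar> \<le> 2 * \<bar>poly P x\<bar>"
      using mult_left_mono[OF s(2), of "\<bar>poly R x\<bar>"] by (simp add: P_def F_def abs_mult mult_ac)
  qed
  obtain l m where lm: "1 \<le> l" "l \<le> m" "m \<le> M + 1" "y l \<le> - A" "A \<le> y m" "- A - \<delta> \<le> y l" "y m \<le> A + \<delta>"
    using nodes_covering_interval[OF mono A0 yA, of \<delta>] gap unfolding \<delta>_def by metis
  have yb: "- (b / 2) \<le> y l" "y m \<le> b / 2"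
    using lm est(3) \<delta> n by (auto simp: b_def)
  have ymono: "y j \<le> y k" if "1 \<le> j" "j \<le> k" "k \<le> M + 1" for j k
    using strict_mono_on_leD[OF mono] that by auto
  have "integral {-A..A} (\<lambda>x. \<bar>F x\<bar>) \<le> integral {-A..A} (\<lambda>x. 2 * \<bar>poly P x\<bar>)"
    using est(3) n by (intro integral_le integrable_continuous_interval cF continuous_intros P_F) (auto simp: b_def)
  also have "\<dots> \<le> 2 * integral {y l..y m} (\<lambda>x. \<bar>poly P x\<bar>)"
    using lm by (auto intro!: integral_subset_le int)
  finally have J1: "integral {-A..A} (\<lambda>x. \<bar>F x\<bar>) \<le> 2 * integral {y l..y m} (\<lambda>x. \<bar>poly P x\<bar>)" .
  have J2: "integral {y l..y m} (\<lambda>x. \<bar>poly P x\<bar>) \<le>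
     (\<Sum>k=l..<m. (y (k + 1) - y k) * \<bar>poly P (y k)\<bar>) + \<delta> * integral {y l..y m} (\<lambda>x. \<bar>poly (pderiv P) x\<bar>)"
    using left_riemann_sum[OF lm(2), of y \<delta> P] gap lm ymono unfolding \<delta>_def by auto
  have J3: "(\<Sum>k=l..<m. (y (k + 1) - y k) * \<bar>poly P (y k)\<bar>) \<le> 3 / 2 * \<Sigma>"
  proof -
    have "(\<Sum>k=l..<m. (y (k + 1) - y k) * \<bar>poly P (y k)\<bar>) \<le> (\<Sum>k=l..<m. (y (k + 1) - y k) * (3 / 2 * \<bar>F (y k)\<bar>))"
    proof (intro sum_mono mult_left_mono P_F)
      fix k assume k: "k \<in> {l..<m}"
      have "y l \<le> y k" "y k \<le> y m" using k lm by (auto intro!: ymono)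
      then show "\<bar>y k\<bar> \<le> b" using yb b by linarith
      show "0 \<le> y (k + 1) - y k" using k lm by (auto intro!: ymono)
    qed
    also have "\<dots> \<le> (\<Sum>k=1..M. (y (k + 1) - y k) * (3 / 2 * \<bar>F (y k)\<bar>))"
      using lm by (intro sum_mono2) (auto intro!: mult_nonneg_nonneg ymono)
    also have "\<dots> = 3 / 2 * \<Sigma>" unfolding \<Sigma>_def sum_distrib_left by (intro sum.cong) auto
    finally show ?thesis .
  qed
  have "integral {y l..y m} (\<lambda>x. \<bar>poly (pderiv P) x\<bar>) \<le> integral {-(b / 2)..b / 2} (\<lambda>x. \<bar>poly (pderiv P) x\<bar>)"
    using yb by (intro integral_subset_le int) auto
  also have "\<dots> \<le> 4 / 3 * (3 * real (2 * d + 2 * N) + 4) / b * integral {-b..b} (\<lambda>x. \<bar>poly P x\<bar>)"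
    by (rule bernstein_interval_L1[OF degP b])
  also have "\<dots> \<le> 4 / 3 * (3 * real (2 * d + 2 * N) + 4) / b * (3 / 2 * I)"
  proof (intro mult_left_mono)
    have "integral {-b..b} (\<lambda>x. \<bar>poly P x\<bar>) \<le> integral {-b..b} (\<lambda>x. 3 / 2 * \<bar>F x\<bar>)"
      by (intro integral_le int integrable_continuous_interval cF continuous_intros P_F) auto
    also have "\<dots> = 3 / 2 * integral {-b..b} (\<lambda>x. \<bar>F x\<bar>)" by simp
    also have "integral {-b..b} (\<lambda>x. \<bar>F x\<bar>) \<le> I"
    proof -
      have "integral {-b..b} (\<lambda>x. \<bar>F x\<bar>) \<le> integral UNIV (\<lambda>x. \<bar>F x\<bar>)"
        using has_integral_integral_lborel[OF iF]
        by (intro integral_subset_le integrable_continuous_interval cF) auto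
      then show ?thesis using has_integral_integral_lborel[OF iF] by (simp add: I_def integral_unique)
    qed
    finally show "integral {-b..b} (\<lambda>x. \<bar>poly P x\<bar>) \<le> 3 / 2 * I" by simp
  qed (use b in auto)
  finally have J4: "\<delta> * integral {y l..y m} (\<lambda>x. \<bar>poly (pderiv P) x\<bar>) \<le>
      \<delta> * (4 / 3 * (3 * real (2 * d + 2 * N) + 4) / b * (3 / 2 * I))"
    using \<delta> by (intro mult_left_mono) auto
  have J: "integral {-A..A} (\<lambda>x. \<bar>F x\<bar>) \<le>
      2 * (3 / 2 * \<Sigma> + \<delta> * (4 / 3 * (3 * real (2 * d + 2 * N) + 4) / b * (3 / 2 * I)))"
    by (intro order_trans[OF J1] mult_left_mono order_trans[OF J2] add_mono J3 J4) auto
  \<comment> \<open>The main term is 6 N, about 4800 n^2. With b = 10 n the Bernstein factor is then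
    at most 1000 n, so the mesh bound 1 / (10000 n) leaves I / 10.\<close>
  have "3 * real (2 * d + 2 * N) + 4 \<le> 5000 * n\<^sup>2"
    using d N_le n2 by (simp add: b_def power_mult_distrib)
  then have "\<delta> * (4 / 3 * (3 * real (2 * d + 2 * N) + 4) / b * (3 / 2 * I)) \<le> \<delta> * (4 / 3 * (5000 * n\<^sup>2) / b * (3 / 2 * I))"
    using \<delta> b I0 by (intro mult_left_mono mult_right_mono divide_right_mono) auto
  also have "\<dots> = I / 10"
    using n by (simp add: \<delta>_def b_def power2_eq_square)
  finally have "integral {-A..A} (\<lambda>x. \<bar>F x\<bar>) \<le> 2 * (3 / 2 * \<Sigma> + I / 10)"
    by (intro order_trans[OF J] mult_left_mono add_left_mono) auto
  \<comment> \<open>This reads I \<le> 4 \<Sigma> + (4/15) I, hence I \<le> (60/11) \<Sigma>, which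
    is rounded up to 6 \<Sigma>.\<close>
  then have "I \<le> 4 / 3 * (2 * (3 / 2 * \<Sigma> + I / 10))"
    using I_le by linarith
  moreover have "\<Sigma> \<ge> 0" unfolding \<Sigma>_def by (intro sum_nonneg mult_nonneg_nonneg) (auto intro!: ymono)
  ultimately have "I \<le> 6 * \<Sigma>" by (simp add: field_simps)
  then show ?thesis unfolding I_def \<Sigma>_def F_def by (simp only: sum_distrib_left mult.assoc)
qed

lemma weighted_quadrature_exists:
  fixes y :: "nat \<Rightarrow> real"
  assumes n: "n \<ge> 1"
      and A: "A = n * sqrt 2 * (1 + 2 * n powr (- 4 / 3))"
      and mono: "strict_mono_on {1..M + 1} y" and yA: "y 1 \<le> - A" "A \<le> y (M + 1)"
      and gap: "\<And>k. 1 \<le> k \<Longrightarrow> k \<le> M \<Longrightarrow> y (k + 1) - y k \<le> 1 / (10000 * n)"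
  shows "\<exists>w. (\<forall>k\<in>{1..M}. \<bar>w k\<bar> \<le> 6 * (y (k + 1) - y k)) \<and>
    (\<forall>P \<in> weighted_polys n. \<forall>Q \<in> weighted_polys n.
        (LINT t|lborel. P t * Q t) = (\<Sum>k = 1..M. w k * P (y k) * Q (y k)))"
proof -
  \<comment> \<open>The largest integer below n^2, as n need not be an integer and the degree bound
    is strict.\<close>
  define d where "d = nat \<lceil>n\<^sup>2\<rceil> - 1"
  have "n\<^sup>2 \<ge> 1" using n by simp
  then have d: "real d < n\<^sup>2" "n\<^sup>2 \<le> real d + 1" unfolding d_def by linarith+
  define V :: "real poly set" where "V = {R. degree R \<le> 2 * d}"
  define L where "L R = (LINT t::real|lborel. exp (- t\<^sup>2) * poly R t)" for R :: "real poly"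
  define p where "p k R = exp (- (y k)\<^sup>2) * poly R (y k)" for k and R :: "real poly"
  have "\<exists>w. (\<forall>k\<in>{1..M}. \<bar>w k\<bar> \<le> 6 * (y (k + 1) - y k)) \<and> (\<forall>v\<in>V. L v = (\<Sum>k\<in>{1..M}. w k * p k v))"
  proof (rule functional_eq_sum_of_dominated)
    show "u + v \<in> V" if "u \<in> V" "v \<in> V" for u v using that by (simp add: V_def degree_add_le)
    show "smult c u \<in> V" if "u \<in> V" for c u
      using that degree_smult_le[of c u] by (simp add: V_def)
    show "L (u + v) = L u + L v" for u v
      unfolding L_def by (simp add: distrib_left integrable_gaussian_poly)
    show "L (smult c u) = c * L u" for c u
      unfolding L_def by (simp add: mult.left_commute)
    show "6 * (y (k + 1) - y k) \<ge> 0" if "k \<in> {1..M}" for k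
      using strict_mono_onD[OF mono, of k "k + 1"] that by simp
    show "L v \<le> (\<Sum>k\<in>{1..M}. 6 * (y (k + 1) - y k) * \<bar>p k v\<bar>)" if "v \<in> V" for v
    proof -
      have "L v \<le> (LINT x|lborel. \<bar>exp (- x\<^sup>2) * poly v x\<bar>)"
        unfolding L_def by (intro integral_mono integrable_abs integrable_gaussian_poly) auto
      also have "\<dots> \<le> (\<Sum>k\<in>{1..M}. 6 * (y (k + 1) - y k) * \<bar>p k v\<bar>)"
        unfolding p_def
        by (rule weighted_poly_integral_le_sum[OF n d(1) _ A mono yA gap]) (use that in \<open>auto simp: V_def\<close>)
      finally show ?thesis .
    qed
  qed (auto simp: p_def distrib_left)
  then obtain w where w: "\<forall>k\<in>{1..M}. \<bar>w k\<bar> \<le> 6 * (y (k + 1) - y k)" "\<And>v. v \<in> V \<Longrightarrow> L v = (\<Sum>k\<in>{1..M}. w k * p k v)"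
    by blast
  have "(LINT t|lborel. P t * Q t) = (\<Sum>k = 1..M. w k * P (y k) * Q (y k))"
    if PQ: "P \<in> weighted_polys n" "Q \<in> weighted_polys n" for P Q
  proof -
    obtain R S where RS: "P = (\<lambda>x. exp (- (x\<^sup>2 / 2)) * poly R x)" "real (degree R) < n\<^sup>2"
        "Q = (\<lambda>x. exp (- (x\<^sup>2 / 2)) * poly S x)" "real (degree S) < n\<^sup>2"
      using PQ unfolding weighted_polys_def by blast
    have eq: "P t * Q t = exp (- t\<^sup>2) * poly (R * S) t" for t
    proof -
      have "exp (- (t\<^sup>2 / 2)) * exp (- (t\<^sup>2 / 2)) = exp (- t\<^sup>2)" by (simp flip: exp_add)
      then show ?thesis unfolding RS by (simp add: mult_ac)
    qed
    have "degree R \<le> d" "degree S \<le> d" using RS d by linarith+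
    then have "R * S \<in> V" unfolding V_def using degree_mult_le[of R S] by simp
    from w(2)[OF this] show ?thesis unfolding L_def p_def by (simp add: eq mult.assoc)
  qed
  with w(1) show ?thesis by blast
qed

theorem theorem7:
  "\<exists>C \<alpha> c0 c1 :: real. \<exists>c3 :: real \<Rightarrow> real \<Rightarrow> real.
     C > 0 \<and> \<alpha> > 0 \<and> c0 > 0 \<and> c1 > 0 \<and>
     (\<forall>\<beta> > 0. \<forall>c2 > 0. c3 \<beta> c2 > 0) \<and>
     (\<forall>(M :: nat) (y :: nat \<Rightarrow> real) (n :: real) (A :: real).
        M \<ge> 1 \<longrightarrow>
        strict_mono_on {1..M + 1} y \<longrightarrow>
        mesh M y \<le> c0 \<longrightarrow>
        n = \<alpha> * inverse (mesh M y) \<longrightarrow>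
        A = n * sqrt 2 * (1 + C * n powr (- 4 / 3)) \<longrightarrow>
        {- A..A} \<subseteq> {y 1..y (M + 1)} \<longrightarrow>
        (\<exists>w :: nat \<Rightarrow> real.
           (\<forall>P \<in> weighted_polys n. \<forall>Q \<in> weighted_polys n.
              (LINT t|lborel. P t * Q t) = (\<Sum>k = 1..M. w k * P (y k) * Q (y k))) \<and>
           (\<forall>k \<in> {1..M}. \<bar>w k\<bar> \<le> c1 * \<bar>y (k + 1) - y k\<bar>) \<and>
           point_masses M w y \<in> MZ n \<and>
           (\<forall>\<beta> > 0. \<forall>c2 > 0.
              {y 1..y (M + 1)} \<subseteq> {- (c2 * n powr \<beta>)..c2 * n powr \<beta>} \<longrightarrow>
              (\<Sum>k = 1..M. \<bar>w k\<bar>) \<le> c3 \<beta> c2 * n powr \<beta>)))"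
\<comment> \<open>With \<alpha> = 1/10000 the mesh is exactly 1 / (10000 n), and the equal value of
  c0 forces n \<ge> 1. The last witness is 6 times the length 2 c2 n^\<beta> of the enclosing
  interval, so it depends on c2 alone.\<close>
proof (rule exI[of _ 2], rule exI[of _ "1 / 10000"], rule exI[of _ "1 / 10000"], rule exI[of _ 6],
    rule exI[of _ "\<lambda>\<beta> c2. 12 * c2"], intro conjI allI impI)
  fix M :: nat and y :: "nat \<Rightarrow> real" and n A :: real
  assume M: "M \<ge> 1" and mono: "strict_mono_on {1..M + 1} y" and mesh: "mesh M y \<le> 1 / 10000"
    and n: "n = 1 / 10000 * inverse (mesh M y)"
    and A: "A = n * sqrt 2 * (1 + 2 * n powr (- 4 / 3))"
    and sub: "{- A..A} \<subseteq> {y 1..y (M + 1)}"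
  have gap0: "y (k + 1) - y k > 0" if "1 \<le> k" "k \<le> M" for k
    using strict_mono_onD[OF mono, of k "k + 1"] that by simp
  have gap_mesh: "y (k + 1) - y k \<le> mesh M y" if "1 \<le> k" "k \<le> M" for k
    unfolding mesh_def using that by (intro Max_ge) auto
  have mesh0: "mesh M y > 0" using gap0[of 1] gap_mesh[of 1] M by simp
  have n1: "n \<ge> 1" unfolding n using mesh mesh0 by (simp add: field_simps)
  have mesh_n: "mesh M y = 1 / (10000 * n)" unfolding n using mesh0 by (simp add: field_simps)
  \<comment> \<open>Only a nonempty [-A, A] lets the inclusion give the two endpoint
    inequalities.\<close>
  have "A > 0" unfolding A using n1 by (intro mult_pos_pos add_pos_nonneg) auto
  then have yA: "y 1 \<le> - A" "A \<le> y (M + 1)" using sub by auto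
  obtain w where w: "\<And>k. 1 \<le> k \<Longrightarrow> k \<le> M \<Longrightarrow> \<bar>w k\<bar> \<le> 6 * (y (k + 1) - y k)"
      and quad: "\<forall>P \<in> weighted_polys n. \<forall>Q \<in> weighted_polys n.
        (LINT t|lborel. P t * Q t) = (\<Sum>k = 1..M. w k * P (y k) * Q (y k))"
    using weighted_quadrature_exists[OF n1 A mono yA] gap_mesh unfolding mesh_n by fastforce
  show "\<exists>w. (\<forall>P \<in> weighted_polys n. \<forall>Q \<in> weighted_polys n.
              (LINT t|lborel. P t * Q t) = (\<Sum>k = 1..M. w k * P (y k) * Q (y k))) \<and>
           (\<forall>k \<in> {1..M}. \<bar>w k\<bar> \<le> 6 * \<bar>y (k + 1) - y k\<bar>) \<and>
           point_masses M w y \<in> MZ n \<and>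
           (\<forall>\<beta> > 0. \<forall>c2 > 0.
              {y 1..y (M + 1)} \<subseteq> {- (c2 * n powr \<beta>)..c2 * n powr \<beta>} \<longrightarrow>
              (\<Sum>k = 1..M. \<bar>w k\<bar>) \<le> 12 * c2 * n powr \<beta>)"
  proof (intro exI[of _ w] conjI quad ballI allI impI)
    show "\<bar>w k\<bar> \<le> 6 * \<bar>y (k + 1) - y k\<bar>" if "k \<in> {1..M}" for k
      using w[of k] gap0[of k] that by simp
    show "point_masses M w y \<in> MZ n"
    proof (rule point_masses_in_MZ[OF _ _ mono _ w])
      show "y (k + 1) - y k \<le> 1 / n" if "1 \<le> k" "k \<le> M" for k
      proof -
        have "1 / (10000 * n) \<le> 1 / n" using n1 by (intro divide_left_mono) auto
        then show ?thesis using gap_mesh[OF that] unfolding mesh_n by linarith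
      qed
    qed (use n1 quad in auto)
    fix \<beta> c2 :: real
    assume "\<beta> > 0" "c2 > 0" and c2: "{y 1..y (M + 1)} \<subseteq> {- (c2 * n powr \<beta>)..c2 * n powr \<beta>}"
    have "y 1 \<le> y (M + 1)" using yA \<open>A > 0\<close> by linarith
    then have ends: "- (c2 * n powr \<beta>) \<le> y 1" "y (M + 1) \<le> c2 * n powr \<beta>" using c2 by auto
    have "(\<Sum>k = 1..M. \<bar>w k\<bar>) \<le> (\<Sum>k = 1..M. 6 * (y (k + 1) - y k))"
      using w by (intro sum_mono) auto
    also have "\<dots> = 6 * (y (M + 1) - y 1)"
      using M sum_Suc_diff[of 1 M y] by (simp only: sum_distrib_left[symmetric]) simp
    also have "\<dots> \<le> 12 * c2 * n powr \<beta>" using ends by (simp add: algebra_simps)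
    finally show "(\<Sum>k = 1..M. \<bar>w k\<bar>) \<le> 12 * c2 * n powr \<beta>" .
  qed
qed auto

end
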